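(* Let $G$ be a definable group. The following statements are equivalent: (1) Every $\sigma$-continuous affine action of $G$ on a non-empty compact convex subset $C$ of a locally convex vector space has a fixed point. (That is: for every such $C$, every basis $\mathcal B$ of the topology of $C$, and every action of $G$ on $C$ by affine maps that is $\sigma$-continuous for $\mathcal B$, there is $c\in C$ with $g\cdot c=c$ for all $g\in G$.) (2) $G$ admits a left-invariant mean over $\ell\text{-RUC}(G)$. (3) For every non-empty compact Hausdorff space $X$, every basis $\mathcal B$ of the topology of $X$, and every action of $G$ on $X$ that is $\sigma$-continuous for $\mathcal B$, there is a $G$-invariant probability measure on $\mathfrak A(X)$, the $\sigma$-algebra on $X$ generated by $\mathcal B$.
   Context: A definable group is a group $G$ whose underlying set and group operation are definable in some first-order structure $M$; "definable" means definable with parameters from $M$. A $\sigma$-topology on a set $X$ is a family $\Sigma$ of subsets of $X$ containing $\emptyset$ and $X$ and closed under finite intersections and countable unions; its members are called $\sigma$-open. The $\sigma$-topology generated by a family of subsets is the smallest $\sigma$-topology containing it. A map between $\sigma$-topological spaces is $\sigma$-continuous if preimages of $\sigma$-open sets are $\sigma$-open. Let $X$ be a topological space and $\mathcal B$ a basis of its topology. An action $G\times X\to X$ is $\sigma$-continuous for $\mathcal B$ if it is a $\sigma$-continuous map when $X$ carries the $\sigma$-topology generated by $\mathcal B$ and $G\times X$ carries the $\sigma$-topology generated by the sets $D\times B$ with $D\subseteq G$ definable and $B\in\mathcal B$. A function $f:G\to\mathbb R$ is logically right uniformly continuous if for each $\varepsilon>0$ there are definable subsets $(\Theta_n^{\varepsilon})_{n<\omega}$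 of $G$ with $G\subseteq\bigcup_{n<\omega}\Theta_n^{\varepsilon}$ such that whenever $g_1,g_2\in\Theta_n^{\varepsilon}$ for some $n$, one has $|f(g_1h)-f(g_2h)|<\varepsilon$ for every $h\in G$. $\ell\text{-RUC}(G)$ is the space of bounded logically right uniformly continuous functions $G\to\mathbb R$, with the supremum norm. A mean over $\ell\text{-RUC}(G)$ is a linear functional $m:\ell\text{-RUC}(G)\to\mathbb R$ with $\inf_{x\in G} f(x)\le m(f)\le\sup_{x\in G} f(x)$ for all $f$. For $a\in G$ put ${}_af(x)=f(ax)$; $m$ is left-invariant if $m({}_af)=m(f)$ for all $a\in G$ and all $f\in\ell\text{-RUC}(G)$. A measure $\mu$ on $\mathfrak A(X)$ is $G$-invariant if $\mu(\{x : g\cdot x\in A\})=\mu(A)$ for all $g\in G$, $A\in\mathfrak A(X)$. Locally convex vector spaces are real and Hausdorff. *)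

theory Defs
  imports
    "HOL-Probability.Probability_Measure"
    "HOL-Algebra.Group_Action"
    "HOL-Library.Function_Algebras"
begin

section \<open>First-order structures and definable sets\<close>

text \<open>
  The universe of a structure is the whole (nonempty) type \<open>'m\<close>; its function and relation
  symbols come from \<open>'f\<close> and \<open>'r\<close>.
\<close>

record ('f, 'r, 'm) fo_structure =
  fun_arity :: "'f \<Rightarrow> nat"
  rel_arity :: "'r \<Rightarrow> nat"
  fun_interp :: "'f \<Rightarrow> 'm list \<Rightarrow> 'm"
  rel_interp :: "'r \<Rightarrow> 'm list \<Rightarrow> bool"

datatype 'f fo_term = FVar nat | FApp 'f "'f fo_term list"

datatype ('f, 'r) fo_formula =
    FEq "'f fo_term" "'f fo_term"
  | FRel 'r "'f fo_term list"
  | FNot "('f, 'r) fo_formula"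
  | FAnd "('f, 'r) fo_formula" "('f, 'r) fo_formula"
  | FEx nat "('f, 'r) fo_formula"

primrec wf_term :: "('f, 'r, 'm) fo_structure \<Rightarrow> 'f fo_term \<Rightarrow> bool" where
  "wf_term M (FVar i) \<longleftrightarrow> True"
| "wf_term M (FApp s ts) \<longleftrightarrow> length ts = fun_arity M s \<and> list_all (wf_term M) ts"

primrec wf_formula :: "('f, 'r, 'm) fo_structure \<Rightarrow> ('f, 'r) fo_formula \<Rightarrow> bool" where
  "wf_formula M (FEq s t) \<longleftrightarrow> wf_term M s \<and> wf_term M t"
| "wf_formula M (FRel R ts) \<longleftrightarrow> length ts = rel_arity M R \<and> list_all (wf_term M) ts"
| "wf_formula M (FNot \<phi>) \<longleftrightarrow> wf_formula M \<phi>"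
| "wf_formula M (FAnd \<phi> \<psi>) \<longleftrightarrow> wf_formula M \<phi> \<and> wf_formula M \<psi>"
| "wf_formula M (FEx i \<phi>) \<longleftrightarrow> wf_formula M \<phi>"

primrec term_val :: "('f, 'r, 'm) fo_structure \<Rightarrow> (nat \<Rightarrow> 'm) \<Rightarrow> 'f fo_term \<Rightarrow> 'm" where
  "term_val M e (FVar i) = e i"
| "term_val M e (FApp s ts) = fun_interp M s (map (term_val M e) ts)"

primrec sat :: "('f, 'r, 'm) fo_structure \<Rightarrow> (nat \<Rightarrow> 'm) \<Rightarrow> ('f, 'r) fo_formula \<Rightarrow> bool" where
  "sat M e (FEq s t) \<longleftrightarrow> term_val M e s = term_val M e t"
| "sat M e (FRel R ts) \<longleftrightarrow> rel_interp M R (map (term_val M e) ts)"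
| "sat M e (FNot \<phi>) \<longleftrightarrow> \<not> sat M e \<phi>"
| "sat M e (FAnd \<phi> \<psi>) \<longleftrightarrow> sat M e \<phi> \<and> sat M e \<psi>"
| "sat M e (FEx i \<phi>) \<longleftrightarrow> (\<exists>a. sat M (e(i := a)) \<phi>)"

text \<open>
  Points of the \<open>n\<close>-th Cartesian power of the universe are lists of length \<open>n\<close>.  The variables
  \<open>0, \<dots>, n - 1\<close> range over the coordinates, and the free variables from \<open>n\<close> on are evaluated by
  \<open>p\<close>: these values are the parameters (finitely many, as a formula has finitely many variables).
\<close>

definition definable :: "('f, 'r, 'm) fo_structure \<Rightarrow> nat \<Rightarrow> 'm list set \<Rightarrow> bool" where
  "definable M n D \<longleftrightarrow>
     (\<exists>\<phi> p. wf_formula M \<phi> \<and>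
        D = {xs. length xs = n \<and> sat M (\<lambda>i. if i < n then xs ! i else p i) \<phi>})"

definition definable_group :: "('f, 'r, 'm) fo_structure \<Rightarrow> nat \<Rightarrow> 'm list monoid \<Rightarrow> bool" where
  "definable_group M n G \<longleftrightarrow>
     group G \<and> definable M n (carrier G) \<and>
     definable M (3 * n) {x @ y @ (x \<otimes>\<^bsub>G\<^esub> y) | x y. x \<in> carrier G \<and> y \<in> carrier G}"


section \<open>Sigma-topologies and sigma-continuous actions\<close>

definition sigma_topology :: "'a set \<Rightarrow> 'a set set \<Rightarrow> bool" where
  "sigma_topology X \<Sigma> \<longleftrightarrow>
     \<Sigma> \<subseteq> Pow X \<and> {} \<in> \<Sigma> \<and> X \<in> \<Sigma> \<and>
     (\<forall>U\<in>\<Sigma>. \<forall>V\<in>\<Sigma>. U \<inter> V \<in> \<Sigma>) \<and>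
     (\<forall>\<U>. countable \<U> \<and> \<U> \<subseteq> \<Sigma> \<longrightarrow> \<Union>\<U> \<in> \<Sigma>)"

definition generated_sigma_topology :: "'a set \<Rightarrow> 'a set set \<Rightarrow> 'a set set" where
  "generated_sigma_topology X \<F> = \<Inter>{\<Sigma>. sigma_topology X \<Sigma> \<and> \<F> \<subseteq> \<Sigma>}"

definition sigma_continuous ::
    "'a set \<Rightarrow> 'a set set \<Rightarrow> 'b set \<Rightarrow> 'b set set \<Rightarrow> ('a \<Rightarrow> 'b) \<Rightarrow> bool" where
  "sigma_continuous X \<Sigma> Y \<T> f \<longleftrightarrow>
     f \<in> X \<rightarrow> Y \<and> (\<forall>V\<in>\<T>. {x \<in> X. f x \<in> V} \<in> \<Sigma>)"

definition is_basis :: "'a topology \<Rightarrow> 'a set set \<Rightarrow> bool" where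
  "is_basis X \<B> \<longleftrightarrow> openin X = arbitrary union_of (\<lambda>U. U \<in> \<B>)"

definition sigma_continuous_action ::
    "('f, 'r, 'm) fo_structure \<Rightarrow> nat \<Rightarrow> 'm list monoid \<Rightarrow> 'x topology \<Rightarrow> 'x set set
      \<Rightarrow> ('m list \<Rightarrow> 'x \<Rightarrow> 'x) \<Rightarrow> bool" where
  "sigma_continuous_action M n G X \<B> \<phi> \<longleftrightarrow>
     group_action G (topspace X) \<phi> \<and>
     sigma_continuous
       (carrier G \<times> topspace X)
       (generated_sigma_topology (carrier G \<times> topspace X)
          {D \<times> B | D B. definable M n D \<and> D \<subseteq> carrier G \<and> B \<in> \<B>})
       (topspace X) (generated_sigma_topology (topspace X) \<B>)
       (\<lambda>(g, x). \<phi> g x)"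


section \<open>Logically right uniformly continuous functions and means\<close>

text \<open>
  A function on \<open>G\<close> is represented by a function on the ambient type, whose values off
  \<open>carrier G\<close> are arbitrary.  The bounds in \<open>is_mean\<close> (together with linearity) force \<open>m f\<close> to
  depend only on the restriction of \<open>f\<close> to \<open>carrier G\<close>, so a mean below is the same thing as a
  mean on the space of functions with domain \<open>carrier G\<close>.
\<close>

definition l_RUC :: "('f, 'r, 'm) fo_structure \<Rightarrow> nat \<Rightarrow> 'm list monoid \<Rightarrow> ('m list \<Rightarrow> real) set" where
  "l_RUC M n G =
     {f. bounded (f ` carrier G) \<and>
         (\<forall>\<epsilon>>0. \<exists>\<Theta> :: nat \<Rightarrow> 'm list set.
            (\<forall>k. definable M n (\<Theta> k) \<and> \<Theta> k \<subseteq> carrier G) \<and>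
            carrier G \<subseteq> (\<Union>k. \<Theta> k) \<and>
            (\<forall>k. \<forall>g\<^sub>1\<in>\<Theta> k. \<forall>g\<^sub>2\<in>\<Theta> k. \<forall>h\<in>carrier G.
               \<bar>f (g\<^sub>1 \<otimes>\<^bsub>G\<^esub> h) - f (g\<^sub>2 \<otimes>\<^bsub>G\<^esub> h)\<bar> < \<epsilon>))}"

definition is_mean ::
    "('f, 'r, 'm) fo_structure \<Rightarrow> nat \<Rightarrow> 'm list monoid \<Rightarrow> (('m list \<Rightarrow> real) \<Rightarrow> real) \<Rightarrow> bool" where
  "is_mean M n G m \<longleftrightarrow>
     (\<forall>f\<in>l_RUC M n G. \<forall>f'\<in>l_RUC M n G. m (\<lambda>x. f x + f' x) = m f + m f') \<and>
     (\<forall>f\<in>l_RUC M n G. \<forall>c::real. m (\<lambda>x. c * f x) = c * m f) \<and>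
     (\<forall>f\<in>l_RUC M n G. (INF x\<in>carrier G. f x) \<le> m f \<and> m f \<le> (SUP x\<in>carrier G. f x))"

definition left_invariant ::
    "('f, 'r, 'm) fo_structure \<Rightarrow> nat \<Rightarrow> 'm list monoid \<Rightarrow> (('m list \<Rightarrow> real) \<Rightarrow> real) \<Rightarrow> bool" where
  "left_invariant M n G m \<longleftrightarrow>
     (\<forall>a\<in>carrier G. \<forall>f\<in>l_RUC M n G. m (\<lambda>x. f (a \<otimes>\<^bsub>G\<^esub> x)) = m f)"

definition has_left_invariant_mean ::
    "('f, 'r, 'm) fo_structure \<Rightarrow> nat \<Rightarrow> 'm list monoid \<Rightarrow> bool" where
  "has_left_invariant_mean M n G \<longleftrightarrow> (\<exists>m. is_mean M n G m \<and> left_invariant M n G m)"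


section \<open>Fixed points of affine actions\<close>

definition locally_convex_space :: "'v::real_vector topology \<Rightarrow> bool" where
  "locally_convex_space T \<longleftrightarrow>
     topspace T = UNIV \<and> Hausdorff_space T \<and>
     continuous_map (prod_topology T T) T (\<lambda>(x, y). x + y) \<and>
     continuous_map (prod_topology euclideanreal T) T (\<lambda>(c, x). c *\<^sub>R x) \<and>
     (\<forall>U. openin T U \<and> 0 \<in> U \<longrightarrow> (\<exists>W. openin T W \<and> convex W \<and> 0 \<in> W \<and> W \<subseteq> U))"

definition affine_action :: "'m list monoid \<Rightarrow> 'v::real_vector set \<Rightarrow> ('m list \<Rightarrow> 'v \<Rightarrow> 'v) \<Rightarrow> bool" where
  "affine_action G C \<phi> \<longleftrightarrow>
     (\<forall>g\<in>carrier G. \<forall>x\<in>C. \<forall>y\<in>C. \<forall>t\<in>{0..1}.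
        \<phi> g ((1 - t) *\<^sub>R x + t *\<^sub>R y) = (1 - t) *\<^sub>R \<phi> g x + t *\<^sub>R \<phi> g y)"

text \<open>
  The last argument is the type of the locally convex spaces quantified over: all locally convex
  topologies on the real vector space \<open>'v\<close>.
\<close>

definition fixed_point_property ::
    "('f, 'r, 'm) fo_structure \<Rightarrow> nat \<Rightarrow> 'm list monoid \<Rightarrow> 'v::real_vector itself \<Rightarrow> bool" where
  "fixed_point_property M n G (_ :: 'v itself) \<longleftrightarrow>
     (\<forall>(T :: 'v topology) C \<B> \<phi>.
        locally_convex_space T \<and> C \<noteq> {} \<and> compactin T C \<and> convex C \<and>
        is_basis (subtopology T C) \<B> \<and>
        sigma_continuous_action M n G (subtopology T C) \<B> \<phi> \<and> affine_action G C \<phi>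
        \<longrightarrow> (\<exists>c\<in>C. \<forall>g\<in>carrier G. \<phi> g c = c))"


section \<open>Invariant measures\<close>

text \<open>The last argument is the type in which the carriers of the compact spaces lie.\<close>

definition invariant_measure_property ::
    "('f, 'r, 'm) fo_structure \<Rightarrow> nat \<Rightarrow> 'm list monoid \<Rightarrow> 'x itself \<Rightarrow> bool" where
  "invariant_measure_property M n G (_ :: 'x itself) \<longleftrightarrow>
     (\<forall>(X :: 'x topology) \<B> \<phi>.
        topspace X \<noteq> {} \<and> compact_space X \<and> Hausdorff_space X \<and> is_basis X \<B> \<and>
        sigma_continuous_action M n G X \<B> \<phi>
        \<longrightarrow> (\<exists>\<mu>. space \<mu> = topspace X \<and> sets \<mu> = sigma_sets (topspace X) \<B> \<and> prob_space \<mu> \<and>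
               (\<forall>g\<in>carrier G. \<forall>A\<in>sets \<mu>.
                  emeasure \<mu> {x \<in> topspace X. \<phi> g x \<in> A} = emeasure \<mu> A)))"


section \<open>Function spaces as real vector spaces\<close>

instantiation "fun" :: (type, real_vector) real_vector
begin

definition scaleR_fun :: "real \<Rightarrow> ('a \<Rightarrow> 'b) \<Rightarrow> 'a \<Rightarrow> 'b" where
  "scaleR_fun c f = (\<lambda>x. c *\<^sub>R f x)"

instance
  by standard (simp_all add: scaleR_fun_def plus_fun_def fun_eq_iff scaleR_right_distrib
      scaleR_left_distrib)

end

text \<open>
  Formulas cannot quantify over types, so conditions on all locally convex or all compact spaces
  are stated relative to a type of spaces.  The type below is a universe for a given group:
  the means on \<open>G\<close> form a compact convex subset of it.
\<close>

type_synonym 'm mean_space = "('m list \<Rightarrow> real) \<Rightarrow> real"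

end

theory Submission
  imports Defs
begin

text \<open>
  A mean on the logically right uniformly continuous functions averages along orbits.  Let \<open>G\<close> act
  sigma-continuously on a compact space \<open>X\<close>, and let \<open>x\<close> be a point of \<open>X\<close>.  For every continuous
  \<open>F\<close> on \<open>X\<close>, compactness makes the function \<open>g \<mapsto> F (g \<cdot> x)\<close> logically right uniformly continuous
  (\<open>orbit_function_l_RUC\<close>).  A left-invariant mean \<open>m\<close> therefore gives a positive normalized functional
  \<open>\<Lambda> F = m (g \<mapsto> F (g \<cdot> x))\<close> on the continuous functions, and \<open>\<Lambda>\<close> is invariant because each group
  element acts by a homeomorphism.  Two conclusions are drawn from it.

  \<^item> The Riesz construction turns \<open>\<Lambda>\<close> into a measure (\<open>outer_mass_measure\<close>).  The construction refers
    to nothing but \<open>\<Lambda>\<close> and the topology, so the measure is invariant (\<open>invariant_measure_of_mean\<close>).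

  \<^item> If \<open>X\<close> is convex, then on affine functions \<open>\<Lambda>\<close> is the evaluation at a point \<open>c\<close>
    (\<open>barycenter_finite\<close> and compactness).  Since \<open>F\<close> and \<open>x \<mapsto> F (g \<cdot> x)\<close> have the same mean, they
    have the same value at \<open>c\<close>.  Continuous linear functionals separate points, by the Hahn-Banach theorem
    (\<open>continuous_functional_nonzero\<close>), so \<open>c\<close> is a fixed point (\<open>fixed_point_of_mean\<close>).

  Conversely, the means themselves form a compact convex set in a product of lines, on which \<open>a \<in> G\<close> acts
  by \<open>(a \<cdot> m) f = m (x \<mapsto> f (a x))\<close>.  A fixed point of this action is a left-invariant mean, and
  averaging the means against an invariant measure produces one.  What needs an argument is that the
  action is sigma-continuous, for the basis of finite intersections of half-spaces \<open>{m. m f < q}\<close>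
  (\<open>mean_action_sigma_continuous\<close>).  Up to an error \<open>1 / k\<close>, uniform continuity of \<open>f\<close> allows \<open>g\<close> to be
  replaced by one of countably many representatives, each responsible for a definable set of group
  elements; this writes the preimage of a half-space as a countable union of rectangles.
\<close>

section \<open>Definable subsets of a definable group\<close>

primrec rename_term :: "(nat \<Rightarrow> nat) \<Rightarrow> 'f fo_term \<Rightarrow> 'f fo_term" where
  "rename_term \<rho> (FVar i) = FVar (\<rho> i)"
| "rename_term \<rho> (FApp s ts) = FApp s (map (rename_term \<rho>) ts)"

primrec rename_formula :: "(nat \<Rightarrow> nat) \<Rightarrow> ('f, 'r) fo_formula \<Rightarrow> ('f, 'r) fo_formula" where
  "rename_formula \<rho> (FEq s t) = FEq (rename_term \<rho> s) (rename_term \<rho> t)"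
| "rename_formula \<rho> (FRel R ts) = FRel R (map (rename_term \<rho>) ts)"
| "rename_formula \<rho> (FNot \<phi>) = FNot (rename_formula \<rho> \<phi>)"
| "rename_formula \<rho> (FAnd \<phi> \<psi>) = FAnd (rename_formula \<rho> \<phi>) (rename_formula \<rho> \<psi>)"
| "rename_formula \<rho> (FEx i \<phi>) = FEx (\<rho> i) (rename_formula \<rho> \<phi>)"

lemma wf_rename_term [simp]: "wf_term M (rename_term \<rho> t) \<longleftrightarrow> wf_term M t"
  by (induction t) (auto simp: list_all_iff)

lemma wf_rename_formula [simp]: "wf_formula M (rename_formula \<rho> \<phi>) \<longleftrightarrow> wf_formula M \<phi>"
  by (induction \<phi>) (auto simp: list_all_iff)

lemma term_val_rename: "term_val M e (rename_term \<rho> t) = term_val M (e \<circ> \<rho>) t"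
proof (induction t)
  case (FApp s ts)
  then have "map (term_val M e) (map (rename_term \<rho>) ts) = map (term_val M (e \<circ> \<rho>)) ts"
    unfolding map_map by (intro map_cong) (simp_all only: comp_def)
  then show ?case
    by (simp only: rename_term.simps term_val.simps)
qed simp

text \<open>
  Bound variables are renamed along with free ones, so injectivity of \<open>\<rho>\<close> is all that is needed to
  avoid capture.
\<close>

lemma sat_rename:
  assumes "inj \<rho>"
  shows "sat M e (rename_formula \<rho> \<phi>) \<longleftrightarrow> sat M (e \<circ> \<rho>) \<phi>"
proof (induction \<phi> arbitrary: e)
  case (FRel R ts)
  have "map (term_val M e) (map (rename_term \<rho>) ts) = map (term_val M (e \<circ> \<rho>)) ts"
    unfolding map_map by (intro map_cong) (simp_all only: comp_apply term_val_rename)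
  then show ?case
    by (simp only: rename_formula.simps sat.simps)
next
  case (FEx i \<phi>)
  have "(e(\<rho> i := a)) \<circ> \<rho> = (e \<circ> \<rho>)(i := a)" for a
    using assms by (auto simp: fun_eq_iff inj_eq)
  then show ?case
    by (simp only: rename_formula.simps sat.simps FEx.IH)
qed (simp_all only: rename_formula.simps sat.simps term_val_rename)

text \<open>
  Closure properties are proved for predicates on assignments instead of formulas: a bare predicate
  has no bound variables to keep apart.
\<close>

definition expressible :: "('f, 'r, 'm) fo_structure \<Rightarrow> ((nat \<Rightarrow> 'm) \<Rightarrow> bool) \<Rightarrow> bool" where
  "expressible M P \<longleftrightarrow> (\<exists>\<phi>. wf_formula M \<phi> \<and> (\<forall>e. sat M e \<phi> \<longleftrightarrow> P e))"

lemma expressible_conj: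
  assumes "expressible M P" "expressible M Q"
  shows "expressible M (\<lambda>e. P e \<and> Q e)"
proof -
  obtain \<phi> \<psi> where "wf_formula M \<phi>" "\<forall>e. sat M e \<phi> \<longleftrightarrow> P e"
    "wf_formula M \<psi>" "\<forall>e. sat M e \<psi> \<longleftrightarrow> Q e"
    using assms by (auto simp: expressible_def)
  then show ?thesis
    unfolding expressible_def by (intro exI[of _ "FAnd \<phi> \<psi>"]) simp
qed

lemma expressible_rename:
  assumes "expressible M P" "inj \<rho>"
  shows "expressible M (\<lambda>e. P (e \<circ> \<rho>))"
proof -
  obtain \<phi> where "wf_formula M \<phi>" "\<forall>e. sat M e \<phi> \<longleftrightarrow> P e"
    using assms by (auto simp: expressible_def)
  then show ?thesis
    unfolding expressible_def
    by (intro exI[of _ "rename_formula \<rho> \<phi>"]) (simp add: sat_rename assms(2))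
qed

lemma expressible_ex:
  assumes "expressible M P"
  shows "expressible M (\<lambda>e. \<exists>a. P (e(i := a)))"
proof -
  obtain \<phi> where "wf_formula M \<phi>" "\<forall>e. sat M e \<phi> \<longleftrightarrow> P e"
    using assms by (auto simp: expressible_def)
  then show ?thesis
    unfolding expressible_def by (intro exI[of _ "FEx i \<phi>"]) simp
qed

lemma expressible_ex_block:
  assumes "expressible M P"
  shows "expressible M
    (\<lambda>e. \<exists>z. length z = n \<and> P (\<lambda>i. if k \<le> i \<and> i < k + n then z ! (i - k) else e i))"
  using assms
proof (induction n arbitrary: P)
  case 0
  have no_update: "(\<lambda>i. if k \<le> i \<and> i < k + 0 then z ! (i - k) else e i) = e"
    for z and e :: "nat \<Rightarrow> 'c"
    by (intro ext) auto
  show ?case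
    unfolding no_update using 0 by simp
next
  case (Suc n)
  define blk where "blk m z e = (\<lambda>i. if k \<le> i \<and> i < k + m then z ! (i - k) else e i)"
    for m z and e :: "nat \<Rightarrow> 'c"
  have upd: "(blk n z e)(k + n := a) = blk (Suc n) (z @ [a]) e"
    if "length z = n" for z a and e :: "nat \<Rightarrow> 'c"
    using that by (auto simp: fun_eq_iff nth_append blk_def)
  have split: "(\<exists>z. length z = Suc n \<and> P (blk (Suc n) z e)) \<longleftrightarrow>
      (\<exists>z. length z = n \<and> (\<exists>a. P ((blk n z e)(k + n := a))))" (is "?L \<longleftrightarrow> ?R") for e
  proof
    assume ?L
    then obtain z where z: "length z = Suc n" "P (blk (Suc n) z e)" by blast
    then obtain w a where w: "z = w @ [a]" "length w = n"
      by (metis length_Suc_conv_rev)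
    show ?R
      using z(2) w upd[OF w(2), of e a] by (intro exI[of _ w] exI[of _ a] conjI) (simp_all only:)
  next
    assume ?R
    then obtain w a where w: "length w = n" "P ((blk n w e)(k + n := a))" by blast
    show ?L
      using w upd[OF w(1), of e a] by (intro exI[of _ "w @ [a]"] conjI) (simp_all only: length_append_singleton)
  qed
  have "expressible M (\<lambda>e. \<exists>z. length z = n \<and> (\<exists>a. P ((blk n z e)(k + n := a))))"
    unfolding blk_def by (rule Suc.IH[OF expressible_ex[OF Suc.prems]])
  then show ?case
    unfolding split[symmetric] unfolding blk_def .
qed

lemma definable_iff_expressible:
  "definable M n D \<longleftrightarrow>
    (\<exists>P p. expressible M P \<and> D = {xs. length xs = n \<and> P (\<lambda>i. if i < n then xs ! i else p i)})"
proof
  assume "definable M n D"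
  then obtain \<phi> p where "wf_formula M \<phi>"
    "D = {xs. length xs = n \<and> sat M (\<lambda>i. if i < n then xs ! i else p i) \<phi>}"
    by (auto simp: definable_def)
  then show "\<exists>P p. expressible M P \<and>
      D = {xs. length xs = n \<and> P (\<lambda>i. if i < n then xs ! i else p i)}"
    by (intro exI[of _ "\<lambda>e. sat M e \<phi>"] exI[of _ p]) (auto simp: expressible_def)
next
  assume "\<exists>P p. expressible M P \<and>
      D = {xs. length xs = n \<and> P (\<lambda>i. if i < n then xs ! i else p i)}"
  then show "definable M n D"
    by (force simp: definable_def expressible_def)
qed

text \<open>
  The two sets come with their own parameters.  These are interleaved: the parameters of \<open>D\<close> move to
  even and those of \<open>E\<close> to odd indices, while the coordinates \<open>i < n\<close> stay in place.
\<close>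

lemma definable_Int:
  assumes "definable M n D" "definable M n E"
  shows "definable M n (D \<inter> E)"
proof -
  obtain P p Q q where P: "expressible M P"
      "D = {xs. length xs = n \<and> P (\<lambda>i. if i < n then xs ! i else p i)}"
    and Q: "expressible M Q"
      "E = {xs. length xs = n \<and> Q (\<lambda>i. if i < n then xs ! i else q i)}"
    using assms by (auto simp: definable_iff_expressible)
  define \<rho> where "\<rho> i = (if i < n then i else 2 * i)" for i
  define \<sigma> where "\<sigma> i = (if i < n then i else 2 * i + 1)" for i
  define r where "r j = (if even j then p (j div 2) else q (j div 2))" for j
  have "inj \<rho>" "inj \<sigma>"
    by (auto simp: inj_def \<rho>_def \<sigma>_def split: if_splits)
  then have "expressible M (\<lambda>e. P (e \<circ> \<rho>) \<and> Q (e \<circ> \<sigma>))"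
    using P Q by (intro expressible_conj expressible_rename)
  moreover have "(\<lambda>i. if i < n then xs ! i else r i) \<circ> \<rho> = (\<lambda>i. if i < n then xs ! i else p i)"
    "(\<lambda>i. if i < n then xs ! i else r i) \<circ> \<sigma> = (\<lambda>i. if i < n then xs ! i else q i)" for xs
    by (auto simp: fun_eq_iff \<rho>_def \<sigma>_def r_def)
  ultimately show ?thesis
    unfolding definable_iff_expressible
    by (intro exI[of _ "\<lambda>e. P (e \<circ> \<rho>) \<and> Q (e \<circ> \<sigma>)"] exI[of _ r]) (auto simp: P Q)
qed

lemma definable_Inter:
  assumes "finite I" "definable M n D" "\<And>i. i \<in> I \<Longrightarrow> definable M n (E i)"
  shows "definable M n (D \<inter> (\<Inter>i\<in>I. E i))"
  using assms
proof (induction I)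
  case (insert i I)
  have "definable M n (E i \<inter> (D \<inter> (\<Inter>i\<in>I. E i)))"
    by (rule definable_Int[OF insert.prems(2) insert.IH[OF insert.prems(1)]])
      (auto intro: insert.prems(2))
  moreover have "E i \<inter> (D \<inter> (\<Inter>i\<in>I. E i)) = D \<inter> (\<Inter>i\<in>insert i I. E i)"
    by blast
  ultimately show ?case by (simp only:)
qed simp

text \<open>
  For \<open>\<Gamma>\<close> the graph of multiplication this set is the preimage of \<open>D\<close> under left translation by \<open>a\<close>.
  In the defining formula the variables below \<open>n\<close> are the point \<open>x\<close>, the next \<open>n\<close> are the quantified
  \<open>z\<close>, and the next \<open>n\<close> hold \<open>a\<close> as a parameter; the parameters of \<open>\<Gamma>\<close> and \<open>D\<close> are interleaved above
  that.
\<close>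

lemma definable_slice_preimage:
  assumes "definable M (3 * n) \<Gamma>" "definable M n D" and a: "length a = n"
  shows "definable M n {x. length x = n \<and> (\<exists>z. length z = n \<and> a @ x @ z \<in> \<Gamma> \<and> z \<in> D)}"
proof -
  obtain P p Q q where P: "expressible M P"
      "\<Gamma> = {xs. length xs = 3 * n \<and> P (\<lambda>i. if i < 3 * n then xs ! i else p i)}"
    and Q: "expressible M Q"
      "D = {xs. length xs = n \<and> Q (\<lambda>i. if i < n then xs ! i else q i)}"
    using assms by (auto simp: definable_iff_expressible)
  define \<rho> where "\<rho> i = (if i < n then 2 * n + i else if i < 3 * n then i - n else 2 * i)" for i
  define \<sigma> where "\<sigma> i = (if i < n then n + i else 2 * (i + 3 * n) + 1)" for i
  define r where "r j = (if j < 3 * n then a ! (j - 2 * n)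
    else if even j then p (j div 2) else q (j div 2 - 3 * n))" for j
  define R where "R e \<longleftrightarrow> P (e \<circ> \<rho>) \<and> Q (e \<circ> \<sigma>)" for e
  define blk where "blk z e = (\<lambda>i. if n \<le> i \<and> i < n + n then z ! (i - n) else e i)"
    for z and e :: "nat \<Rightarrow> 'c"
  have "inj \<rho>" "inj \<sigma>"
    by (auto simp: inj_def \<rho>_def \<sigma>_def split: if_splits)
  then have "expressible M R"
    unfolding R_def using P Q by (intro expressible_conj expressible_rename)
  then have ex: "expressible M (\<lambda>e. \<exists>z. length z = n \<and> R (blk z e))"
    unfolding blk_def by (rule expressible_ex_block)
  have "blk z (\<lambda>i. if i < n then x ! i else r i) \<circ> \<rho> =
      (\<lambda>i. if i < 3 * n then (a @ x @ z) ! i else p i)"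
    "blk z (\<lambda>i. if i < n then x ! i else r i) \<circ> \<sigma> = (\<lambda>i. if i < n then z ! i else q i)"
    if "length x = n" "length z = n" for x z
    using that a
     by (auto simp: fun_eq_iff blk_def \<rho>_def \<sigma>_def r_def nth_append)
  then have "R (blk z (\<lambda>i. if i < n then x ! i else r i)) \<longleftrightarrow> a @ x @ z \<in> \<Gamma> \<and> z \<in> D"
    if "length x = n" "length z = n" for x z
    using that a by (simp add: R_def P Q)
  then have "{x. length x = n \<and> (\<exists>z. length z = n \<and> a @ x @ z \<in> \<Gamma> \<and> z \<in> D)} =
    {x. length x = n \<and> (\<exists>z. length z = n \<and> R (blk z (\<lambda>i. if i < n then x ! i else r i)))}"
    by auto
  with ex show ?thesis
    unfolding definable_iff_expressible
    by (intro exI[of _ "\<lambda>e. \<exists>z. length z = n \<and> R (blk z e)"] exI[of _ r] conjI)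
qed

lemma definable_translate:
  assumes G: "definable_group M n G" and D: "definable M n D" and a: "a \<in> carrier G"
  shows "definable M n {x \<in> carrier G. a \<otimes>\<^bsub>G\<^esub> x \<in> D}"
proof -
  interpret group G using G by (simp add: definable_group_def)
  define \<Gamma> where "\<Gamma> = {x @ y @ (x \<otimes>\<^bsub>G\<^esub> y) | x y. x \<in> carrier G \<and> y \<in> carrier G}"
  have \<Gamma>: "definable M (3 * n) \<Gamma>" and carrier: "definable M n (carrier G)"
    using G by (simp_all only: definable_group_def \<Gamma>_def)
  have len: "length x = n" if "x \<in> carrier G" for x
    using that carrier unfolding definable_def by blast
  have graph: "x \<in> carrier G \<and> z = a \<otimes>\<^bsub>G\<^esub> x" if \<Gamma>_mem: "a @ x @ z \<in> \<Gamma>" and x: "length x = n" for x z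
  proof -
    obtain b y where *: "a @ x @ z = b @ y @ (b \<otimes>\<^bsub>G\<^esub> y)" "b \<in> carrier G" "y \<in> carrier G"
      using \<Gamma>_mem by (auto simp only: \<Gamma>_def mem_Collect_eq)
    then have "a = b \<and> x = y \<and> z = b \<otimes>\<^bsub>G\<^esub> y"
      using len[OF a] len[OF *(2)] len[OF *(3)] x by simp
    with * show ?thesis by simp
  qed
  have "{x \<in> carrier G. a \<otimes>\<^bsub>G\<^esub> x \<in> D} =
    {x. length x = n \<and> (\<exists>z. length z = n \<and> a @ x @ z \<in> \<Gamma> \<and> z \<in> D)}" (is "?L = ?R")
  proof (intro equalityI subsetI)
    fix x assume "x \<in> ?L"
    then have x: "x \<in> carrier G" "a \<otimes>\<^bsub>G\<^esub> x \<in> D" by simp_all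
    then have "a @ x @ (a \<otimes>\<^bsub>G\<^esub> x) \<in> \<Gamma>" using a unfolding \<Gamma>_def by blast
    with x len a show "x \<in> ?R" by (intro CollectI conjI exI[of _ "a \<otimes>\<^bsub>G\<^esub> x"]) simp_all
  next
    fix x assume "x \<in> ?R"
    with graph show "x \<in> ?L" by blast
  qed
  with definable_slice_preimage[OF \<Gamma> D len[OF a]] show ?thesis by simp
qed

section \<open>Continuous linear functionals separate points\<close>

definition sublinear :: "('v::real_vector \<Rightarrow> real) \<Rightarrow> bool" where
  "sublinear p \<longleftrightarrow> (\<forall>x y. p (x + y) \<le> p x + p y) \<and> (\<forall>c\<ge>0. \<forall>x. p (c *\<^sub>R x) \<le> c * p x)"

lemma sublinear_add: "sublinear p \<Longrightarrow> p (x + y) \<le> p x + p y"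
  by (simp add: sublinear_def)

lemma sublinear_scale: "sublinear p \<Longrightarrow> 0 \<le> c \<Longrightarrow> p (c *\<^sub>R x) \<le> c * p x"
  by (simp add: sublinear_def)

lemma sublinear_zero: "sublinear p \<Longrightarrow> p 0 = 0"
  using sublinear_add[of p 0 0] sublinear_scale[of p 0 0] by simp

lemma sublinear_minus: "sublinear p \<Longrightarrow> - p (- x) \<le> p x"
  using sublinear_add[of p x "- x"] sublinear_zero[of p] by simp

lemma sublinear_scale_eq:
  assumes "sublinear p" "0 < c"
  shows "p (c *\<^sub>R x) = c * p x"
proof -
  have "p x \<le> (1 / c) * p (c *\<^sub>R x)"
    using sublinear_scale[OF assms(1), of "1 / c" "c *\<^sub>R x"] assms(2) by simp
  then have "c * p x \<le> p (c *\<^sub>R x)"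
    using assms(2) by (simp add: field_simps)
  with sublinear_scale[OF assms(1), of c x] assms(2) show ?thesis by simp
qed

text \<open>
  The largest sublinear functional below \<open>p\<close> with value \<open>- p y\<close> at \<open>- y\<close>.  A sublinear \<open>p\<close> is
  linear exactly if no \<open>y\<close> shrinks it.
\<close>

definition shrink_along :: "'v::real_vector \<Rightarrow> ('v \<Rightarrow> real) \<Rightarrow> 'v \<Rightarrow> real" where
  "shrink_along y p x = (INF t\<in>{0..}. p (x + t *\<^sub>R y) - t * p y)"

lemma shrink_along_bdd:
  assumes "sublinear p"
  shows "bdd_below ((\<lambda>t. p (x + t *\<^sub>R y) - t * p y) ` {0..})"
proof (rule bdd_belowI2[where m = "- p (- x)"])
  fix t :: real assume "t \<in> {0..}"
  then have "p (t *\<^sub>R y) = t * p y"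
    by (cases "t = 0") (simp_all add: sublinear_scale_eq[OF assms] sublinear_zero[OF assms])
  then show "- p (- x) \<le> p (x + t *\<^sub>R y) - t * p y"
    using sublinear_add[OF assms, of "x + t *\<^sub>R y" "- x"] by simp
qed

lemma shrink_along_le:
  assumes "sublinear p" "0 \<le> t"
  shows "shrink_along y p x \<le> p (x + t *\<^sub>R y) - t * p y"
  unfolding shrink_along_def using assms by (intro cINF_lower shrink_along_bdd) auto

lemma shrink_along_sublinear:
  assumes "sublinear p"
  shows "sublinear (shrink_along y p)"
  unfolding sublinear_def
proof (intro conjI allI impI)
  fix x1 x2
  have *: "shrink_along y p (x1 + x2) \<le> (p (x1 + s *\<^sub>R y) - s * p y) + (p (x2 + t *\<^sub>R y) - t * p y)"
    if "0 \<le> s" "0 \<le> t" for s t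
    using shrink_along_le[OF assms, of "s + t" y "x1 + x2"] that
      sublinear_add[OF assms, of "x1 + s *\<^sub>R y" "x2 + t *\<^sub>R y"]
    by (simp add: algebra_simps)
  have "shrink_along y p (x1 + x2) - (p (x2 + t *\<^sub>R y) - t * p y) \<le> shrink_along y p x1"
    if "0 \<le> t" for t
    unfolding shrink_along_def[of y p x1] using *[OF _ that]
    by (intro cINF_greatest) (auto simp: algebra_simps)
  then have "shrink_along y p (x1 + x2) - shrink_along y p x1 \<le> shrink_along y p x2"
    unfolding shrink_along_def[of y p x2] by (intro cINF_greatest) (auto simp: algebra_simps)
  then show "shrink_along y p (x1 + x2) \<le> shrink_along y p x1 + shrink_along y p x2" by simp
next
  fix c :: real and x assume "0 \<le> c"
  show "shrink_along y p (c *\<^sub>R x) \<le> c * shrink_along y p x"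
  proof (cases "c = 0")
    case True
    then show ?thesis
      using shrink_along_le[OF assms, of 0 y 0] sublinear_zero[OF assms] by simp
  next
    case False
    with \<open>0 \<le> c\<close> have "0 < c" by simp
    have "shrink_along y p (c *\<^sub>R x) / c \<le> p (x + t *\<^sub>R y) - t * p y" if "0 \<le> t" for t
    proof -
      have "shrink_along y p (c *\<^sub>R x) \<le> p (c *\<^sub>R (x + t *\<^sub>R y)) - c * t * p y"
        using shrink_along_le[OF assms, of "c * t" y "c *\<^sub>R x"] that \<open>0 < c\<close>
        by (simp add: algebra_simps)
      also have "\<dots> = c * (p (x + t *\<^sub>R y) - t * p y)"
        by (simp only: sublinear_scale_eq[OF assms \<open>0 < c\<close>]) (simp add: algebra_simps)
      finally show ?thesis using \<open>0 < c\<close> by (simp add: field_simps)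
    qed
    then have "shrink_along y p (c *\<^sub>R x) / c \<le> shrink_along y p x"
      unfolding shrink_along_def[of y p x] by (intro cINF_greatest) auto
    with \<open>0 < c\<close> show ?thesis by (simp add: field_simps)
  qed
qed

text \<open>
  By Zorn's lemma; the pointwise infimum of a chain stays finite because every sublinear \<open>q \<le> p\<close>
  satisfies \<open>- p (- x) \<le> q x\<close>.
\<close>

lemma minimal_sublinear_below:
  assumes p: "sublinear p"
  obtains q where "sublinear q" "\<And>x. q x \<le> p x"
    "\<And>r. sublinear r \<Longrightarrow> (\<And>x. r x \<le> q x) \<Longrightarrow> r = q"
proof -
  define A where "A = {q. sublinear q \<and> (\<forall>x. q x \<le> p x)}"
  define P where "P = (\<lambda>a b :: 'a \<Rightarrow> real. \<forall>x. b x \<le> a x)"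
  have "\<exists>m\<in>A. \<forall>a\<in>A. P m a \<longrightarrow> a = m"
  proof (rule predicate_Zorn)
    show "partial_order_on A (relation_of P A)"
      by (rule partial_order_on_relation_ofI)
        (auto simp: P_def fun_eq_iff intro: order_trans antisym)
  next
    fix C assume C: "C \<in> Chains (relation_of P A)"
    then have CA: "C \<subseteq> A" by (auto simp: Chains_def relation_of_def)
    show "\<exists>u\<in>A. \<forall>a\<in>C. P a u"
    proof (cases "C = {}")
      case True
      then show ?thesis using p by (auto simp: A_def)
    next
      case False
      define u where "u x = (INF q\<in>C. q x)" for x
      have bdd: "bdd_below ((\<lambda>q. q x) ` C)" for x
      proof (rule bdd_belowI2[where m = "- p (- x)"])
        fix q assume "q \<in> C"
        with CA have "sublinear q" "q (- x) \<le> p (- x)" by (auto simp: A_def)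
        with sublinear_minus[of q x] show "- p (- x) \<le> q x" by simp
      qed
      have le: "u x \<le> q x" if "q \<in> C" for q x
        unfolding u_def using that bdd by (intro cINF_lower)
      have greatest: "c \<le> u x" if "\<And>q. q \<in> C \<Longrightarrow> c \<le> q x" for c x
        unfolding u_def using False that by (intro cINF_greatest)
      have "sublinear u"
        unfolding sublinear_def
      proof (intro conjI allI impI)
        fix x y
        have "u (x + y) \<le> q1 x + q2 y" if q: "q1 \<in> C" "q2 \<in> C" for q1 q2
        proof -
          have "P q1 q2 \<or> P q2 q1"
            using C q by (auto simp: Chains_def relation_of_def)
          then obtain q where "q \<in> C" "\<And>z. q z \<le> q1 z" "\<And>z. q z \<le> q2 z"
            using q by (auto simp: P_def)
          moreover from this have "sublinear q" using CA by (auto simp: A_def)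
          ultimately show ?thesis
            using le[of q "x + y"] sublinear_add[of q x y] by (smt (verit))
        qed
        then have "u (x + y) - q2 y \<le> u x" if "q2 \<in> C" for q2
          using that by (intro greatest) (simp add: algebra_simps)
        then have "u (x + y) - u x \<le> u y"
          by (intro greatest) (simp add: algebra_simps)
        then show "u (x + y) \<le> u x + u y" by simp
      next
        fix c :: real and x assume c: "0 \<le> c"
        have *: "u (c *\<^sub>R x) \<le> c * q x" if "q \<in> C" for q
          using le[OF that, of "c *\<^sub>R x"] sublinear_scale[of q c x] that CA c
          by (force simp: A_def)
        show "u (c *\<^sub>R x) \<le> c * u x"
        proof (cases "c = 0")
          case True
          then show ?thesis using * False by auto
        next
          case nz: False
          have "u (c *\<^sub>R x) / c \<le> u x"
            using * c nz by (intro greatest) (simp add: field_simps)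
          then show ?thesis using c nz by (simp add: field_simps)
        qed
      qed
      moreover have "u x \<le> p x" for x
        using False le[of _ x] CA by (force simp: A_def intro: order_trans)
      ultimately show ?thesis
        using le by (intro bexI[of _ u]) (auto simp: A_def P_def)
    qed
  qed
  then obtain q where "q \<in> A" and min: "\<And>a. a \<in> A \<Longrightarrow> P q a \<Longrightarrow> a = q" by blast
  show thesis
  proof (rule that)
    show "sublinear q" "\<And>x. q x \<le> p x" using \<open>q \<in> A\<close> by (auto simp: A_def)
    fix r assume "sublinear r" "\<And>x. r x \<le> q x"
    with \<open>q \<in> A\<close> show "r = q"
      by (intro min) (auto simp: A_def P_def intro: order_trans)
  qed
qed

text \<open>
  A minimal sublinear functional cannot be shrunk along any \<open>y\<close>, which makes it superadditive, hence
  linear.  Starting the descent from \<open>shrink_along v p\<close> forces the value \<open>p v\<close> at \<open>v\<close>.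
\<close>

theorem Hahn_Banach_dominated:
  fixes p :: "'v::real_vector \<Rightarrow> real"
  assumes p: "sublinear p"
  obtains l where "linear l" "\<And>x. l x \<le> p x" "p v \<le> l v"
proof -
  obtain l where l: "sublinear l" and le: "\<And>x. l x \<le> shrink_along v p x"
    and min: "\<And>r. sublinear r \<Longrightarrow> (\<And>x. r x \<le> l x) \<Longrightarrow> r = l"
    using minimal_sublinear_below[OF shrink_along_sublinear[OF p]] by blast
  have eq: "shrink_along y l = l" for y
    using shrink_along_le[OF l, of 0 y] by (intro min shrink_along_sublinear l) simp
  have add: "l (x + y) = l x + l y" for x y
    using shrink_along_le[OF l, of 1 y x] sublinear_add[OF l, of x y] by (simp add: eq)
  have minus: "l (- x) = - l x" for x
    using add[of x "- x"] sublinear_zero[OF l] by simp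
  have nonneg: "l (c *\<^sub>R x) = c * l x" if "0 \<le> c" for c x
    using that sublinear_scale_eq[OF l] sublinear_zero[OF l] by (cases "c = 0") simp_all
  have "l (c *\<^sub>R x) = c * l x" for c x
    using nonneg[of c x] nonneg[of "- c" x] minus[of "c *\<^sub>R x"] by (cases "0 \<le> c") simp_all
  with add have "linear l" by (intro linearI) simp_all
  moreover have "l x \<le> p x" for x
    using le[of x] shrink_along_le[OF p, of 0 v x] by simp
  moreover have "p v \<le> l v"
    using le[of "- v"] shrink_along_le[OF p, of 1 v "- v"] minus[of v] sublinear_zero[OF p] by simp
  ultimately show thesis by (rule that)
qed

definition minkowski :: "'v::real_vector set \<Rightarrow> 'v \<Rightarrow> real" where
  "minkowski W x = Inf {t. 0 < t \<and> (1 / t) *\<^sub>R x \<in> W}"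

lemma minkowski_le:
  assumes "0 < t" "(1 / t) *\<^sub>R x \<in> W"
  shows "minkowski W x \<le> t"
  unfolding minkowski_def using assms by (intro cInf_lower bdd_belowI[where m = 0]) auto

lemma minkowski_greatest:
  assumes "\<exists>t>0. (1 / t) *\<^sub>R x \<in> W" "\<And>t. 0 < t \<Longrightarrow> (1 / t) *\<^sub>R x \<in> W \<Longrightarrow> c \<le> t"
  shows "c \<le> minkowski W x"
  unfolding minkowski_def using assms by (intro cInf_greatest) auto

lemma minkowski_sublinear:
  assumes "convex W" and absorbing: "\<And>x. \<exists>t>0. (1 / t) *\<^sub>R x \<in> W"
  shows "sublinear (minkowski W)"
  unfolding sublinear_def
proof (intro conjI allI impI)
  fix x y
  have *: "minkowski W (x + y) \<le> s + t"
    if s: "0 < s" "(1 / s) *\<^sub>R x \<in> W" and t: "0 < t" "(1 / t) *\<^sub>R y \<in> W" for s t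
  proof (rule minkowski_le)
    have "(s / (s + t)) *\<^sub>R ((1 / s) *\<^sub>R x) + (t / (s + t)) *\<^sub>R ((1 / t) *\<^sub>R y) \<in> W"
      using assms(1) s t by (intro convexD) (auto simp: add_divide_distrib[symmetric])
    then show "(1 / (s + t)) *\<^sub>R (x + y) \<in> W"
      using s t by (simp add: scaleR_right_distrib)
  qed (use s t in simp)
  have "minkowski W (x + y) - t \<le> minkowski W x" if "0 < t" "(1 / t) *\<^sub>R y \<in> W" for t
    using *[OF _ _ that] by (intro minkowski_greatest absorbing) (simp add: algebra_simps)
  then have "minkowski W (x + y) - minkowski W x \<le> minkowski W y"
    by (intro minkowski_greatest absorbing) (simp add: algebra_simps)
  then show "minkowski W (x + y) \<le> minkowski W x + minkowski W y" by simp
next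
  fix c :: real and x assume "0 \<le> c"
  show "minkowski W (c *\<^sub>R x) \<le> c * minkowski W x"
  proof (cases "c = 0")
    case True
    have "0 \<in> W" using absorbing[of 0] by auto
    then have "minkowski W 0 \<le> t" if "0 < t" for t
      using that by (intro minkowski_le) simp_all
    then have "minkowski W 0 \<le> 0" by (rule field_le_epsilon[where y = 0, simplified])
    with True show ?thesis by simp
  next
    case False
    with \<open>0 \<le> c\<close> have "0 < c" by simp
    then have "minkowski W (c *\<^sub>R x) \<le> c * t" if "0 < t" "(1 / t) *\<^sub>R x \<in> W" for t
      using that by (intro minkowski_le) simp_all
    then have "minkowski W (c *\<^sub>R x) / c \<le> minkowski W x"
      using \<open>0 < c\<close> by (intro minkowski_greatest absorbing) (simp add: field_simps)
    with \<open>0 < c\<close> show ?thesis by (simp add: field_simps)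
  qed
qed

lemma continuous_map_scale_diff:
  assumes "locally_convex_space T"
  shows "continuous_map T T (\<lambda>y. c *\<^sub>R (y + a))"
proof -
  have UNIV: "topspace T = UNIV"
    and add: "continuous_map (prod_topology T T) T (\<lambda>(x, y). x + y)"
    and scale: "continuous_map (prod_topology euclideanreal T) T (\<lambda>(c, x). c *\<^sub>R x)"
    using assms by (simp_all add: locally_convex_space_def)
  have "continuous_map T (prod_topology T T) (\<lambda>y. (y, a))"
    by (simp add: continuous_map_pairedI UNIV)
  from continuous_map_compose[OF this add] have 1: "continuous_map T T (\<lambda>y. y + a)"
    by (simp add: o_def)
  have "continuous_map T (prod_topology euclideanreal T) (\<lambda>y. (c, y + a))"
    using 1 by (simp add: continuous_map_pairedI)
  from continuous_map_compose[OF this scale] show ?thesis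
    by (simp add: o_def)
qed

lemma open_nhd_absorbing:
  assumes T: "locally_convex_space T" and W: "openin T W" "0 \<in> W"
  shows "\<exists>t>0. (1 / t) *\<^sub>R x \<in> W"
proof -
  have UNIV: "topspace T = UNIV"
    and scale: "continuous_map (prod_topology euclideanreal T) T (\<lambda>(c, x). c *\<^sub>R x)"
    using T by (simp_all add: locally_convex_space_def)
  have "continuous_map euclideanreal (prod_topology euclideanreal T) (\<lambda>c. (c, x))"
    by (simp add: continuous_map_pairedI UNIV)
  from continuous_map_compose[OF this scale] have "continuous_map euclideanreal T (\<lambda>c. c *\<^sub>R x)"
    by (simp add: o_def)
  from openin_continuous_map_preimage[OF this W(1)] have "open {c. c *\<^sub>R x \<in> W}" by simp
  then obtain e where "0 < e" "ball 0 e \<subseteq> {c. c *\<^sub>R x \<in> W}"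
    using W(2) openE[of "{c. c *\<^sub>R x \<in> W}" 0] by auto
  then have "(1 / (2 / e)) *\<^sub>R x \<in> W" by (auto simp: dist_norm subset_iff)
  then show ?thesis using \<open>0 < e\<close> by (intro exI[of _ "2 / e"]) simp
qed

text \<open>
  The Minkowski functional of a convex open neighbourhood of \<open>0\<close> that misses \<open>v\<close> is at least \<open>1\<close> at
  \<open>v\<close>; a linear functional that it dominates and that agrees with it at \<open>v\<close> is bounded by \<open>1\<close> on the
  neighbourhood, and therefore continuous.
\<close>

theorem continuous_functional_nonzero:
  fixes v :: "'v::real_vector"
  assumes T: "locally_convex_space T" and "v \<noteq> 0"
  obtains l where "linear l" "continuous_map T euclideanreal l" "l v \<noteq> 0"
proof -
  have UNIV: "topspace T = UNIV" using T by (simp add: locally_convex_space_def)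
  have "Hausdorff_space T" using T by (simp add: locally_convex_space_def)
  then obtain U where "openin T U" "0 \<in> U" "v \<notin> U"
    using \<open>v \<noteq> 0\<close> unfolding Hausdorff_space_def UNIV disjnt_def by blast
  then obtain W where W: "openin T W" "convex W" "0 \<in> W" "v \<notin> W"
    using T unfolding locally_convex_space_def by blast
  note absorbing = open_nhd_absorbing[OF T W(1,3)]
  have "1 \<le> minkowski W v"
  proof (rule minkowski_greatest[OF absorbing])
    fix t :: real assume t: "0 < t" "(1 / t) *\<^sub>R v \<in> W"
    show "1 \<le> t"
    proof (rule ccontr)
      assume "\<not> 1 \<le> t"
      then have "t *\<^sub>R ((1 / t) *\<^sub>R v) + (1 - t) *\<^sub>R 0 \<in> W"
        using t W by (intro convexD) auto
      with t W(4) show False by simp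
    qed
  qed
  moreover obtain l where l: "linear l" "\<And>x. l x \<le> minkowski W x" "minkowski W v \<le> l v"
    using Hahn_Banach_dominated[OF minkowski_sublinear[OF W(2) absorbing]] by blast
  ultimately have "l v \<noteq> 0" by auto
  have le1: "l x \<le> 1" if "x \<in> W" for x
    using l(2)[of x] minkowski_le[of 1 x W] that by simp
  have "continuous_map T euclideanreal l"
    unfolding continuous_map_def
  proof (intro conjI allI impI)
    fix O' :: "real set" assume "openin euclideanreal O'"
    then have O': "open O'" by simp
    show "openin T {x \<in> topspace T. l x \<in> O'}"
    proof (subst openin_subopen, intro ballI)
      fix x assume "x \<in> {x \<in> topspace T. l x \<in> O'}"
      then obtain e where e: "0 < e" "\<And>r. dist r (l x) < e \<Longrightarrow> r \<in> O'"
        using O' by (auto simp: open_dist)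
      define N where "N = {y \<in> topspace T. (2 / e) *\<^sub>R (y + - x) \<in> W} \<inter>
        {y \<in> topspace T. (- 2 / e) *\<^sub>R (y + - x) \<in> W}"
      have "openin T N"
        unfolding N_def using W(1) continuous_map_scale_diff[OF T]
        by (intro openin_Int openin_continuous_map_preimage)
      moreover have "x \<in> N" using W(3) UNIV by (simp add: N_def)
      moreover have "N \<subseteq> {x \<in> topspace T. l x \<in> O'}"
      proof
        fix y assume "y \<in> N"
        then have "l ((2 / e) *\<^sub>R (y + - x)) \<le> 1" "l ((- 2 / e) *\<^sub>R (y + - x)) \<le> 1"
          by (auto simp only: N_def intro: le1)
        then have "(2 / e) * (l y - l x) \<le> 1" "(- 2 / e) * (l y - l x) \<le> 1"
          using l(1) by (simp_all only: linear_scale linear_add linear_neg real_scaleR_def diff_conv_add_uminus)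
        then have "\<bar>l y - l x\<bar> < e"
          using e(1) by (auto simp: field_simps abs_less_iff)
        then show "y \<in> {x \<in> topspace T. l x \<in> O'}"
          using e(2) by (simp add: dist_real_def UNIV)
      qed
      ultimately show "\<exists>N. openin T N \<and> x \<in> N \<and> N \<subseteq> {x \<in> topspace T. l x \<in> O'}" by blast
    qed
  qed simp
  with l(1) \<open>l v \<noteq> 0\<close> show thesis using that by blast
qed

section \<open>The outer measure of a positive functional\<close>

text \<open>
  The measure of the Riesz representation theorem, as far as it is needed: \<open>outer_mass\<close> is an outer
  measure for which open sets are measurable.  It depends only on the topology and on \<open>\<Lambda>\<close>, so that
  homeomorphisms that preserve \<open>\<Lambda>\<close> preserve it.  A Baire measure would not do, because the members of
  a basis need not be Baire sets.
\<close>

locale normalized_positive_functional =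
  fixes X :: "'x topology" and \<Lambda> :: "('x \<Rightarrow> real) \<Rightarrow> real"
  assumes compact: "compact_space X" and Hausdorff: "Hausdorff_space X"
    and mono: "\<And>f g. continuous_map X euclideanreal f \<Longrightarrow> continuous_map X euclideanreal g \<Longrightarrow>
      (\<And>x. x \<in> topspace X \<Longrightarrow> f x \<le> g x) \<Longrightarrow> \<Lambda> f \<le> \<Lambda> g"
    and add: "\<And>f g. continuous_map X euclideanreal f \<Longrightarrow> continuous_map X euclideanreal g \<Longrightarrow>
      \<Lambda> (\<lambda>x. f x + g x) = \<Lambda> f + \<Lambda> g"
    and const: "\<And>c. \<Lambda> (\<lambda>_. c) = c"
begin

definition subordinate :: "'x set \<Rightarrow> ('x \<Rightarrow> real) set" where
  "subordinate U = {f. continuous_map X euclideanreal f \<and>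
    (\<forall>x\<in>topspace X. 0 \<le> f x \<and> f x \<le> 1 \<and> (x \<notin> U \<longrightarrow> f x = 0))}"

definition open_mass :: "'x set \<Rightarrow> ennreal" where
  "open_mass U = (SUP f\<in>subordinate U. ennreal (\<Lambda> f))"

definition outer_mass :: "'x set \<Rightarrow> ennreal" where
  "outer_mass A = (INF U\<in>{U. openin X U \<and> A \<subseteq> U}. open_mass U)"

lemma subordinate_continuous: "f \<in> subordinate U \<Longrightarrow> continuous_map X euclideanreal f"
  by (simp add: subordinate_def)

lemma zero_subordinate: "(\<lambda>_. 0) \<in> subordinate U"
  by (simp add: subordinate_def)

lemma open_mass_upper: "f \<in> subordinate U \<Longrightarrow> ennreal (\<Lambda> f) \<le> open_mass U"
  unfolding open_mass_def by (rule SUP_upper)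

lemma open_mass_least:
  assumes "\<And>f e. f \<in> subordinate U \<Longrightarrow> 0 < e \<Longrightarrow> ennreal (\<Lambda> f) \<le> c + ennreal e"
  shows "open_mass U \<le> c"
  unfolding open_mass_def by (rule SUP_least, rule ennreal_le_epsilon, rule assms)

lemma open_mass_mono: "U \<subseteq> V \<Longrightarrow> open_mass U \<le> open_mass V"
  unfolding open_mass_def by (rule SUP_subset_mono) (auto simp: subordinate_def)

lemma nonneg: "f \<in> subordinate U \<Longrightarrow> 0 \<le> \<Lambda> f"
  using mono[of "\<lambda>_. 0" f] const[of 0] by (auto simp: subordinate_def)

lemma le_one: "f \<in> subordinate U \<Longrightarrow> \<Lambda> f \<le> 1"
  using mono[of f "\<lambda>_. 1"] const[of 1] by (auto simp: subordinate_def)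

lemma open_mass_le_one: "open_mass U \<le> 1"
  unfolding open_mass_def using le_one by (intro SUP_least) auto

lemma open_mass_topspace: "open_mass (topspace X) = 1"
proof (rule antisym[OF open_mass_le_one])
  have "(\<lambda>_. 1) \<in> subordinate (topspace X)" by (simp add: subordinate_def)
  from open_mass_upper[OF this] show "1 \<le> open_mass (topspace X)" by (simp add: const)
qed

lemma open_mass_empty: "open_mass {} = 0"
proof -
  have "\<Lambda> f \<le> 0" if "f \<in> subordinate {}" for f
    using that mono[of f "\<lambda>_. 0"] const[of 0] by (auto simp: subordinate_def)
  then have "open_mass {} \<le> 0"
    unfolding open_mass_def by (intro SUP_least) (auto simp: ennreal_neg)
  then show ?thesis by simp
qed

lemma open_mass_approx:
  assumes "0 < e"
  obtains f where "f \<in> subordinate U" "open_mass U \<le> ennreal (\<Lambda> f) + ennreal e"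
proof (cases "open_mass U \<le> ennreal e")
  case True
  then show thesis
    using that[OF zero_subordinate] const[of 0] by simp
next
  case False
  have fin: "open_mass U < top_class.top" using open_mass_le_one[of U] by (simp add: le_less_trans)
  have pos: "0 < open_mass U" using False by (auto simp: zero_less_iff_neq_zero)
  have "open_mass U - ennreal e < open_mass U"
    using assms fin pos by (intro ennreal_between) auto
  then obtain f where "f \<in> subordinate U" "open_mass U - ennreal e < ennreal (\<Lambda> f)"
    unfolding open_mass_def[of U] less_SUP_iff by blast
  moreover from this(2) have "open_mass U \<le> ennreal (\<Lambda> f) + ennreal e"
    using fin by (metis add.commute ennreal_minus_le_iff less_imp_le)
  ultimately show thesis using that by blast
qed

text \<open>
  The closed support of a function subordinate to an open set need not lie inside that set.  Lowering
  the function by \<open>e\<close> changes \<open>\<Lambda>\<close> by at most \<open>e\<close> and leaves a function that vanishes off the compact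
  set \<open>{x. e \<le> f x}\<close>.
\<close>

lemma truncate_subordinate:
  assumes f: "f \<in> subordinate U" and e: "0 \<le> e"
    and V: "\<And>x. x \<in> topspace X \<Longrightarrow> e < f x \<Longrightarrow> x \<in> V"
  shows "(\<lambda>x. max 0 (f x - e)) \<in> subordinate V"
proof -
  have "continuous_map X euclideanreal (\<lambda>x. max 0 (f x - e))"
    using subordinate_continuous[OF f] by (intro continuous_intros)
  moreover have "0 \<le> f x" "f x \<le> 1" if "x \<in> topspace X" for x
    using f that by (auto simp: subordinate_def)
  ultimately show ?thesis
    using V e unfolding subordinate_def by (fastforce simp: max_def)
qed

lemma functional_le_truncate:
  assumes f: "continuous_map X euclideanreal f"
  shows "\<Lambda> f \<le> \<Lambda> (\<lambda>x. max 0 (f x - e)) + e"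
proof -
  have cont: "continuous_map X euclideanreal (\<lambda>x. max 0 (f x - e))"
    using f by (intro continuous_intros)
  then have "\<Lambda> f \<le> \<Lambda> (\<lambda>x. max 0 (f x - e) + e)"
    using f by (intro mono continuous_map_add) auto
  with add[OF cont, of "\<lambda>_. e"] const[of e] show ?thesis by simp
qed

lemma superlevel_closedin:
  assumes "continuous_map X euclideanreal f"
  shows "closedin X {x \<in> topspace X. e \<le> f x}"
  using closedin_continuous_map_preimage[OF assms, of "{e..}"] by simp

text \<open>
  A Urysohn function \<open>g\<close> cuts \<open>f\<close> in two: \<open>f * g\<close> is subordinate to \<open>U\<close>, and \<open>f * (1 - g)\<close> is at most
  \<open>e\<close> outside \<open>V\<close>, so that its truncation is subordinate to \<open>V\<close>.
\<close>

lemma open_mass_Un: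
  assumes U: "openin X U" and V: "openin X V"
  shows "open_mass (U \<union> V) \<le> open_mass U + open_mass V"
proof (rule open_mass_least)
  fix f and e :: real assume f: "f \<in> subordinate (U \<union> V)" and e: "0 < e"
  note f_cont = subordinate_continuous[OF f]
  define K where "K = {x \<in> topspace X. e \<le> f x} - V"
  have "closedin X K"
    unfolding K_def using superlevel_closedin[OF f_cont] V by (rule closedin_diff)
  moreover have "closedin X (topspace X - U)" using U by (intro closedin_diff closedin_topspace)
  moreover have "disjnt (topspace X - U) K"
    using f e by (force simp: disjnt_def K_def subordinate_def)
  moreover have "normal_space X"
    using compact Hausdorff compact_Hausdorff_or_regular_imp_normal_space by blast
  ultimately obtain g where g: "continuous_map X (top_of_set {0..1::real}) g"
      "g ` (topspace X - U) \<subseteq> {0}" "g ` K \<subseteq> {1}"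
    using Urysohn_lemma[of X "topspace X - U" K 0 1] by auto
  have g_cont: "continuous_map X euclideanreal g" and g01: "\<And>x. x \<in> topspace X \<Longrightarrow> 0 \<le> g x \<and> g x \<le> 1"
    using g(1) by (auto simp: continuous_map_in_subtopology image_subset_iff)
  define f1 where "f1 = (\<lambda>x. f x * g x)"
  define f2 where "f2 = (\<lambda>x. f x * (1 - g x))"
  have cont: "continuous_map X euclideanreal f1" "continuous_map X euclideanreal f2"
    unfolding f1_def f2_def using f_cont g_cont by (intro continuous_intros; simp)+
  have f01: "0 \<le> f x" "f x \<le> 1" if "x \<in> topspace X" for x
    using f that by (auto simp: subordinate_def)
  have f1: "f1 \<in> subordinate U"
    using cont(1) f01 g01 g(2) by (auto simp: subordinate_def f1_def image_subset_iff mult_le_one)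
  have "f2 \<in> subordinate (topspace X)"
    using cont(2) f01 g01 by (auto simp: subordinate_def f2_def mult_le_one)
  moreover have "x \<in> V" if x: "x \<in> topspace X" "e < f2 x" for x
  proof (rule ccontr)
    assume "x \<notin> V"
    have "f2 x \<le> f x"
      using f01[OF x(1)] g01[OF x(1)] mult_left_le[of "1 - g x" "f x"] by (simp add: f2_def)
    with x \<open>x \<notin> V\<close> have "x \<in> K" by (simp add: K_def)
    with g(3) have "f2 x = 0" by (auto simp: f2_def image_subset_iff)
    with x(2) e show False by simp
  qed
  ultimately have f2: "(\<lambda>x. max 0 (f2 x - e)) \<in> subordinate V"
    using e by (intro truncate_subordinate) auto
  have "\<Lambda> f = \<Lambda> f1 + \<Lambda> f2"
    using add[OF cont] by (simp add: f1_def f2_def algebra_simps)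
  also have "\<dots> \<le> \<Lambda> f1 + \<Lambda> (\<lambda>x. max 0 (f2 x - e)) + e"
    using functional_le_truncate[OF cont(2), of e] by simp
  finally have "ennreal (\<Lambda> f) \<le> ennreal (\<Lambda> f1 + \<Lambda> (\<lambda>x. max 0 (f2 x - e)) + e)"
    by (rule ennreal_leI)
  also have "\<dots> = ennreal (\<Lambda> f1) + ennreal (\<Lambda> (\<lambda>x. max 0 (f2 x - e))) + ennreal e"
    using nonneg[OF f1] nonneg[OF f2] e by (simp add: ennreal_plus)
  also have "\<dots> \<le> open_mass U + open_mass V + ennreal e"
    using open_mass_upper[OF f1] open_mass_upper[OF f2] by (intro add_mono) auto
  finally show "ennreal (\<Lambda> f) \<le> open_mass U + open_mass V + ennreal e" .
qed

lemma open_mass_finite_UN: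
  assumes "\<And>i. openin X (U i)"
  shows "open_mass (\<Union>i<n::nat. U i) \<le> (\<Sum>i<n. open_mass (U i))"
proof (induction n)
  case 0
  then show ?case by (simp add: open_mass_empty)
next
  case (Suc n)
  have "open_mass (\<Union>i<Suc n. U i) = open_mass ((\<Union>i<n. U i) \<union> U n)"
    by (simp add: lessThan_Suc Un_commute)
  also have "\<dots> \<le> open_mass (\<Union>i<n. U i) + open_mass (U n)"
    using assms by (intro open_mass_Un) auto
  also have "\<dots> \<le> (\<Sum>i<Suc n. open_mass (U i))"
    using Suc by (simp add: add_right_mono)
  finally show ?case .
qed

text \<open>
  The compact set on which \<open>f\<close> is at least \<open>e\<close> is covered by finitely many of the \<open>U i\<close>, which reduces
  the countable case to finite unions.
\<close>

lemma open_mass_UN: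
  assumes U: "\<And>i. openin X (U i)"
  shows "open_mass (\<Union>i::nat. U i) \<le> (\<Sum>i. open_mass (U i))"
proof (rule open_mass_least)
  fix f and e :: real assume f: "f \<in> subordinate (\<Union>i. U i)" and e: "0 < e"
  note f_cont = subordinate_continuous[OF f]
  have "compactin X {x \<in> topspace X. e \<le> f x}"
    using compact superlevel_closedin[OF f_cont] by (rule closedin_compact_space)
  moreover have "{x \<in> topspace X. e \<le> f x} \<subseteq> \<Union> (range U)"
    using f e by (force simp: subordinate_def)
  ultimately obtain \<F> where \<F>: "finite \<F>" "\<F> \<subseteq> range U" "{x \<in> topspace X. e \<le> f x} \<subseteq> \<Union> \<F>"
    using compactinD[of X "{x \<in> topspace X. e \<le> f x}" "range U"] U by auto
  then obtain I where I: "finite I" "\<F> = U ` I"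
    by (metis finite_subset_image)
  then obtain n where "I \<subseteq> {..<n}"
    using finite_nat_iff_bounded by blast
  then have "\<Union> \<F> \<subseteq> (\<Union>i<n. U i)" unfolding I(2) by (intro UN_mono) auto
  with \<F>(3) have cover: "{x \<in> topspace X. e \<le> f x} \<subseteq> (\<Union>i<n. U i)" by (rule order_trans)
  have sub: "(\<lambda>x. max 0 (f x - e)) \<in> subordinate (\<Union>i<n. U i)"
    using cover e by (intro truncate_subordinate[OF f]) auto
  have "ennreal (\<Lambda> f) \<le> ennreal (\<Lambda> (\<lambda>x. max 0 (f x - e)) + e)"
    by (intro ennreal_leI functional_le_truncate f_cont)
  also have "\<dots> = ennreal (\<Lambda> (\<lambda>x. max 0 (f x - e))) + ennreal e"
    using nonneg[OF sub] e by (simp add: ennreal_plus)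
  also have "\<dots> \<le> open_mass (\<Union>i<n. U i) + ennreal e"
    using open_mass_upper[OF sub] by (intro add_mono) auto
  also have "\<dots> \<le> (\<Sum>i<n. open_mass (U i)) + ennreal e"
    using open_mass_finite_UN[of U n] U by (intro add_mono) auto
  also have "\<dots> \<le> (\<Sum>i. open_mass (U i)) + ennreal e"
    by (intro add_mono sum_le_suminf) auto
  finally show "ennreal (\<Lambda> f) \<le> (\<Sum>i. open_mass (U i)) + ennreal e" .
qed

lemma outer_mass_open: "openin X U \<Longrightarrow> outer_mass U = open_mass U"
  unfolding outer_mass_def by (intro antisym INF_lower INF_greatest) (auto intro: open_mass_mono)

lemma outer_mass_le: "openin X U \<Longrightarrow> A \<subseteq> U \<Longrightarrow> outer_mass A \<le> open_mass U"
  unfolding outer_mass_def by (rule INF_lower) simp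

lemma outer_mass_mono: "A \<subseteq> B \<Longrightarrow> outer_mass A \<le> outer_mass B"
  unfolding outer_mass_def by (rule INF_superset_mono) auto

lemma outer_mass_UN: "outer_mass (\<Union>i::nat. A i) \<le> (\<Sum>i. outer_mass (A i))"
proof (rule ennreal_le_epsilon)
  fix e :: real assume e: "0 < e" and fin: "(\<Sum>i. outer_mass (A i)) < top_class.top"
  have "\<exists>U. openin X U \<and> A i \<subseteq> U \<and> open_mass U \<le> outer_mass (A i) + e * (1/2)^Suc i" for i
  proof -
    have "outer_mass (A i) < outer_mass (A i) + e * (1/2)^Suc i"
      using e ennreal_suminf_lessD[OF fin, of i] by (simp add: less_top)
    then show ?thesis
      unfolding outer_mass_def[of "A i"] INF_less_iff by (auto intro: less_imp_le)
  qed
  then obtain U where U: "\<And>i. openin X (U i)" "\<And>i. A i \<subseteq> U i"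
      "\<And>i. open_mass (U i) \<le> outer_mass (A i) + e * (1/2)^Suc i"
    by metis
  have "outer_mass (\<Union>i. A i) \<le> open_mass (\<Union>i. U i)"
    using U by (intro outer_mass_le) blast+
  also have "\<dots> \<le> (\<Sum>i. open_mass (U i))"
    using U(1) by (rule open_mass_UN)
  also have "\<dots> \<le> (\<Sum>i. outer_mass (A i) + e * (1/2)^Suc i)"
    using U(3) by (intro suminf_le) auto
  also have "\<dots> = (\<Sum>i. outer_mass (A i)) + (\<Sum>i. ennreal e * ennreal ((1/2) ^ Suc i))"
    using e by (subst suminf_add[symmetric])
      (auto simp del: ennreal_suminf_cmult simp add: ennreal_mult[symmetric])
  also have "\<dots> = (\<Sum>i. outer_mass (A i)) + e"
    unfolding ennreal_suminf_cmult
    by (subst suminf_ennreal_eq[OF zero_le_power power_half_series]) auto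
  finally show "outer_mass (\<Union>i. A i) \<le> (\<Sum>i. outer_mass (A i)) + e" .
qed

lemma outer_mass_space: "outer_measure_space (Pow (topspace X)) outer_mass"
  unfolding outer_measure_space_def positive_def increasing_def countably_subadditive_def
  using outer_mass_mono outer_mass_UN by (simp add: outer_mass_open open_mass_empty)

text \<open>
  Caratheodory's condition for an open test set \<open>V\<close>.  Functions nearly attaining the masses of
  \<open>V \<inter> U\<close> and of \<open>V - K\<close>, with \<open>K\<close> the superlevel set of the first, are never both nonzero once the
  first is truncated, so their sum is subordinate to \<open>V\<close>.
\<close>

lemma open_mass_split:
  assumes U: "openin X U" and V: "openin X V"
  shows "outer_mass (V \<inter> U) + outer_mass (V - U) \<le> open_mass V"
proof (rule ennreal_le_epsilon)
  fix \<epsilon> :: real assume "0 < \<epsilon>"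
  define e where "e = \<epsilon> / 3"
  have e: "0 < e" using \<open>0 < \<epsilon>\<close> by (simp add: e_def)
  obtain f where f: "f \<in> subordinate (V \<inter> U)"
      "open_mass (V \<inter> U) \<le> ennreal (\<Lambda> f) + ennreal e"
    using open_mass_approx[OF e] .
  note f_cont = subordinate_continuous[OF f(1)]
  define K where "K = {x \<in> topspace X. e \<le> f x}"
  have K: "openin X (V - K)"
    using V superlevel_closedin[OF f_cont] unfolding K_def by (rule openin_diff)
  obtain g where g: "g \<in> subordinate (V - K)"
      "open_mass (V - K) \<le> ennreal (\<Lambda> g) + ennreal e"
    using open_mass_approx[OF e] .
  note g_cont = subordinate_continuous[OF g(1)]
  define f' where "f' = (\<lambda>x. max 0 (f x - e))"
  have f': "f' \<in> subordinate (V \<inter> U)"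
    unfolding f'_def using f(1) e by (intro truncate_subordinate) (auto simp: subordinate_def)
  note f'_cont = subordinate_continuous[OF f']
  have "(\<lambda>x. f' x + g x) \<in> subordinate V"
    unfolding subordinate_def
  proof (intro CollectI conjI ballI)
    show "continuous_map X euclideanreal (\<lambda>x. f' x + g x)"
      using f'_cont g_cont by (rule continuous_map_add)
    fix x assume x: "x \<in> topspace X"
    have fx: "0 \<le> f' x" "f' x \<le> 1" "x \<notin> V \<Longrightarrow> f' x = 0" using f' x by (auto simp: subordinate_def)
    have gx: "0 \<le> g x" "g x \<le> 1" "x \<notin> V \<Longrightarrow> g x = 0" using g(1) x by (auto simp: subordinate_def)
    have "f' x = 0 \<or> g x = 0"
      using g(1) x by (cases "x \<in> K") (auto simp: subordinate_def K_def f'_def)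
    with fx gx show "0 \<le> f' x + g x" "f' x + g x \<le> 1" "x \<notin> V \<longrightarrow> f' x + g x = 0" by auto
  qed
  from open_mass_upper[OF this] have sum: "ennreal (\<Lambda> f' + \<Lambda> g) \<le> open_mass V"
    by (simp add: add[OF f'_cont g_cont])
  have "\<Lambda> f \<le> \<Lambda> f' + e"
    unfolding f'_def by (rule functional_le_truncate[OF f_cont])
  then have 1: "ennreal (\<Lambda> f) \<le> ennreal (\<Lambda> f') + ennreal e"
    using nonneg[OF f'] e by (metis ennreal_leI ennreal_plus less_imp_le)
  have "outer_mass (V \<inter> U) + outer_mass (V - U) \<le> open_mass (V \<inter> U) + open_mass (V - K)"
  proof (intro add_mono outer_mass_le)
    show "V - U \<subseteq> V - K"
      using f(1) e openin_subset[OF V] by (force simp: subordinate_def K_def)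
  qed (use K U V in auto)
  also have "\<dots> \<le> (ennreal (\<Lambda> f') + ennreal e + ennreal e) + (ennreal (\<Lambda> g) + ennreal e)"
    using f(2) g(2) 1 by (intro add_mono) (auto intro: order_trans add_right_mono)
  also have "\<dots> = ennreal (\<Lambda> f' + \<Lambda> g) + ennreal \<epsilon>"
  proof -
    have "ennreal \<epsilon> = ennreal e + ennreal e + ennreal e"
      using e by (simp add: ennreal_plus[symmetric] e_def del: ennreal_plus)
    then show ?thesis
      using nonneg[OF f'] nonneg[OF g(1)] by (simp add: ennreal_plus ac_simps)
  qed
  also have "\<dots> \<le> open_mass V + ennreal \<epsilon>" using sum by (rule add_right_mono)
  finally show "outer_mass (V \<inter> U) + outer_mass (V - U) \<le> open_mass V + ennreal \<epsilon>" .
qed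

lemma open_in_lambda_system:
  assumes U: "openin X U"
  shows "U \<in> lambda_system (topspace X) (Pow (topspace X)) outer_mass"
proof -
  interpret sigma_algebra "topspace X" "Pow (topspace X)" by (rule sigma_algebra_Pow)
  have "outer_mass (A \<inter> U) + outer_mass (A - U) = outer_mass A" for A
  proof (rule antisym)
    show "outer_mass (A \<inter> U) + outer_mass (A - U) \<le> outer_mass A"
      unfolding outer_mass_def[of A]
    proof (rule INF_greatest)
      fix V assume "V \<in> {V. openin X V \<and> A \<subseteq> V}"
      then have V: "openin X V" "A \<subseteq> V" by auto
      then have "outer_mass (A \<inter> U) + outer_mass (A - U) \<le> outer_mass (V \<inter> U) + outer_mass (V - U)"
        by (intro add_mono outer_mass_mono) auto
      with open_mass_split[OF U V(1)]
      show "outer_mass (A \<inter> U) + outer_mass (A - U) \<le> open_mass V" by (rule order_trans[rotated])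
    qed
    define B where "B i = (if i = 0 then A \<inter> U else if i = 1 then A - U else {})" for i :: nat
    have "(\<Union>i. B i) = A" by (auto simp: B_def split: if_splits)
    moreover have "(\<Sum>i. outer_mass (B i)) = (\<Sum>i\<in>{0,1}. outer_mass (B i))"
      by (rule suminf_finite) (auto simp: B_def outer_mass_open open_mass_empty)
    ultimately show "outer_mass A \<le> outer_mass (A \<inter> U) + outer_mass (A - U)"
      using outer_mass_UN[of B] by (simp add: B_def)
  qed
  then show ?thesis
    unfolding lambda_system_eq using openin_subset[OF U] by auto
qed

lemma outer_mass_measure:
  assumes B: "B \<subseteq> Collect (openin X)"
  defines "\<mu> \<equiv> measure_of (topspace X) B outer_mass"
  shows "space \<mu> = topspace X" "sets \<mu> = sigma_sets (topspace X) B"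
    "A \<in> sets \<mu> \<Longrightarrow> emeasure \<mu> A = outer_mass A" "prob_space \<mu>"
proof -
  have BPow: "B \<subseteq> Pow (topspace X)" using B openin_subset by blast
  show sp: "space \<mu> = topspace X" and st: "sets \<mu> = sigma_sets (topspace X) B"
    using BPow by (simp_all add: \<mu>_def space_measure_of sets_measure_of)
  define L where "L = lambda_system (topspace X) (Pow (topspace X)) outer_mass"
  have "measure_space (topspace X) L outer_mass"
    unfolding L_def by (rule sigma_algebra.caratheodory_lemma[OF sigma_algebra_Pow outer_mass_space])
  moreover from this have "sigma_sets (topspace X) B \<subseteq> L"
    using B open_in_lambda_system unfolding measure_space_def L_def
    by (intro sigma_algebra.sigma_sets_subset) auto
  ultimately have ms: "measure_space (topspace X) (sigma_sets (topspace X) B) outer_mass"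
    by (rule measure_down[OF _ sigma_algebra_sigma_sets[OF BPow]])
  show em: "emeasure \<mu> A = outer_mass A" if "A \<in> sets \<mu>" for A
    using ms that BPow st
    by (intro emeasure_measure_of[OF \<mu>_def[THEN meta_eq_to_obj_eq]]) (auto simp: measure_space_def)
  have "emeasure \<mu> (space \<mu>) = 1"
    using em[OF sets.top] by (simp add: sp outer_mass_open open_mass_topspace)
  then show "prob_space \<mu>" by (rule prob_spaceI)
qed

text \<open>
  Composition with \<open>T\<close> carries the functions subordinate to \<open>U\<close> to functions subordinate to the
  preimage of \<open>U\<close>, without changing \<open>\<Lambda>\<close>.  The same for the inverse \<open>S\<close> gives the opposite inequality.
\<close>

lemma outer_mass_vimage:
  assumes T: "continuous_map X X T" and S: "continuous_map X X S"
    and ST: "\<And>x. x \<in> topspace X \<Longrightarrow> S (T x) = x" and TS: "\<And>x. x \<in> topspace X \<Longrightarrow> T (S x) = x"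
    and invT: "\<And>f. continuous_map X euclideanreal f \<Longrightarrow> \<Lambda> (\<lambda>x. f (T x)) = \<Lambda> f"
    and invS: "\<And>f. continuous_map X euclideanreal f \<Longrightarrow> \<Lambda> (\<lambda>x. f (S x)) = \<Lambda> f"
    and A: "A \<subseteq> topspace X"
  shows "outer_mass {x \<in> topspace X. T x \<in> A} = outer_mass A"
proof -
  have open_le: "open_mass U \<le> open_mass {x \<in> topspace X. R x \<in> U}"
    if R: "continuous_map X X R" and inv: "\<And>f. continuous_map X euclideanreal f \<Longrightarrow> \<Lambda> (\<lambda>x. f (R x)) = \<Lambda> f"
    for R U
    unfolding open_mass_def[of U]
  proof (rule SUP_least)
    fix f assume f: "f \<in> subordinate U"
    have "(\<lambda>x. f (R x)) \<in> subordinate {x \<in> topspace X. R x \<in> U}"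
      using f R continuous_map_compose[OF R subordinate_continuous[OF f]]
        continuous_map_image_subset_topspace[OF R]
      by (auto simp: subordinate_def o_def image_subset_iff)
    from open_mass_upper[OF this] inv[OF subordinate_continuous[OF f]]
    show "ennreal (\<Lambda> f) \<le> open_mass {x \<in> topspace X. R x \<in> U}" by simp
  qed
  have outer_le: "outer_mass {x \<in> topspace X. R x \<in> A} \<le> outer_mass A"
    if R: "continuous_map X X R" and Q: "continuous_map X X Q"
      and RQ: "\<And>x. x \<in> topspace X \<Longrightarrow> R (Q x) = x"
      and inv: "\<And>f. continuous_map X euclideanreal f \<Longrightarrow> \<Lambda> (\<lambda>x. f (Q x)) = \<Lambda> f"
    for R Q A
    unfolding outer_mass_def[of A]
  proof (rule INF_greatest)
    fix U assume "U \<in> {U. openin X U \<and> A \<subseteq> U}"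
    then have U: "openin X U" "A \<subseteq> U" by auto
    define U' where "U' = {x \<in> topspace X. R x \<in> U}"
    have "openin X U'" unfolding U'_def using R U(1) by (rule openin_continuous_map_preimage)
    then have "outer_mass {x \<in> topspace X. R x \<in> A} \<le> open_mass U'"
      using U(2) by (intro outer_mass_le) (auto simp: U'_def)
    also have "\<dots> \<le> open_mass {x \<in> topspace X. Q x \<in> U'}"
      using open_le[OF Q inv] .
    also have "\<dots> \<le> open_mass U"
      using RQ by (intro open_mass_mono) (auto simp: U'_def)
    finally show "outer_mass {x \<in> topspace X. R x \<in> A} \<le> open_mass U" .
  qed
  have eq: "{x \<in> topspace X. S x \<in> {x \<in> topspace X. T x \<in> A}} = A"
    using A TS continuous_map_image_subset_topspace[OF S] by (auto simp: image_subset_iff)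
  show ?thesis
    using outer_le[OF T S TS invS, of A] outer_le[OF S T ST invT, of "{x \<in> topspace X. T x \<in> A}"]
    unfolding eq by (rule antisym)
qed

end

section \<open>Logically right uniformly continuous functions and their means\<close>

locale definable_group_on =
  fixes M :: "('f, 'r, 'm) fo_structure" and n :: nat and G :: "'m list monoid" (structure)
  assumes definable_group: "definable_group M n G"
begin

sublocale group G
  using definable_group by (simp add: definable_group_def)

lemma carrier_definable: "definable M n (carrier G)"
  using definable_group by (simp only: definable_group_def)

lemma carrier_nonempty: "carrier G \<noteq> {}"
  by (rule carrier_not_empty)

lemma l_RUC_I:
  assumes "bounded (f ` carrier G)"
    and "\<And>e. 0 < e \<Longrightarrow> \<exists>\<Theta> :: nat \<Rightarrow> 'm list set.
            (\<forall>k. definable M n (\<Theta> k) \<and> \<Theta> k \<subseteq> carrier G) \<and> carrier G \<subseteq> (\<Union>k. \<Theta> k) \<and>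
            (\<forall>k. \<forall>g\<in>\<Theta> k. \<forall>g'\<in>\<Theta> k. \<forall>h\<in>carrier G. \<bar>f (g \<otimes> h) - f (g' \<otimes> h)\<bar> < e)"
  shows "f \<in> l_RUC M n G"
  using assms unfolding l_RUC_def by blast

lemma l_RUC_E:
  assumes "f \<in> l_RUC M n G" "0 < (e::real)"
  obtains \<Theta> :: "nat \<Rightarrow> 'm list set" where "\<And>k. definable M n (\<Theta> k)" "\<And>k. \<Theta> k \<subseteq> carrier G"
    "\<And>g. g \<in> carrier G \<Longrightarrow> \<exists>k. g \<in> \<Theta> k"
    "\<And>k g g' h. g \<in> \<Theta> k \<Longrightarrow> g' \<in> \<Theta> k \<Longrightarrow> h \<in> carrier G \<Longrightarrow> \<bar>f (g \<otimes> h) - f (g' \<otimes> h)\<bar> < e"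
proof -
  obtain \<Theta> :: "nat \<Rightarrow> 'm list set" where "(\<forall>k. definable M n (\<Theta> k) \<and> \<Theta> k \<subseteq> carrier G)"
    "carrier G \<subseteq> (\<Union>k. \<Theta> k)"
    "(\<forall>k. \<forall>g\<in>\<Theta> k. \<forall>g'\<in>\<Theta> k. \<forall>h\<in>carrier G. \<bar>f (g \<otimes> h) - f (g' \<otimes> h)\<bar> < e)"
    using assms unfolding l_RUC_def by blast
  then show thesis by (intro that[of \<Theta>]) auto
qed

lemma l_RUC_bounded: "f \<in> l_RUC M n G \<Longrightarrow> bounded (f ` carrier G)"
  by (simp add: l_RUC_def)

lemma l_RUC_cong:
  assumes f: "f \<in> l_RUC M n G" and eq: "\<And>x. x \<in> carrier G \<Longrightarrow> f x = f' x"
  shows "f' \<in> l_RUC M n G"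
proof (rule l_RUC_I)
  show "bounded (f' ` carrier G)"
    using l_RUC_bounded[OF f] eq by (metis image_cong)
  fix e :: real assume "0 < e"
  from l_RUC_E[OF f this] obtain \<Theta> :: "nat \<Rightarrow> 'm list set" where
    \<Theta>: "\<And>k. definable M n (\<Theta> k)" "\<And>k. \<Theta> k \<subseteq> carrier G"
    "\<And>g. g \<in> carrier G \<Longrightarrow> \<exists>k. g \<in> \<Theta> k"
    "\<And>k g g' h. g \<in> \<Theta> k \<Longrightarrow> g' \<in> \<Theta> k \<Longrightarrow> h \<in> carrier G \<Longrightarrow> \<bar>f (g \<otimes> h) - f (g' \<otimes> h)\<bar> < e"
    by blast
  have "\<bar>f' (g \<otimes> h) - f' (g' \<otimes> h)\<bar> < e"
    if "g \<in> \<Theta> k" "g' \<in> \<Theta> k" "h \<in> carrier G" for k g g' h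
    using \<Theta>(4)[OF that] \<Theta>(2)[of k] that by (simp add: subset_iff eq[symmetric])
  with \<Theta>(1-3) show "\<exists>\<Theta> :: nat \<Rightarrow> 'm list set.
      (\<forall>k. definable M n (\<Theta> k) \<and> \<Theta> k \<subseteq> carrier G) \<and> carrier G \<subseteq> (\<Union>k. \<Theta> k) \<and>
      (\<forall>k. \<forall>g\<in>\<Theta> k. \<forall>g'\<in>\<Theta> k. \<forall>h\<in>carrier G. \<bar>f' (g \<otimes> h) - f' (g' \<otimes> h)\<bar> < e)"
    by (intro exI[of _ \<Theta>]) auto
qed

lemma l_RUC_const: "(\<lambda>_. c) \<in> l_RUC M n G"
proof (rule l_RUC_I)
  show "bounded ((\<lambda>_. c) ` carrier G)" by (simp add: image_constant_conv)
qed (use carrier_definable in \<open>intro exI[of _ "\<lambda>_. carrier G"], auto\<close>)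

lemma l_RUC_scale:
  assumes f: "f \<in> l_RUC M n G"
  shows "(\<lambda>x. c * f x) \<in> l_RUC M n G"
proof (rule l_RUC_I)
  show "bounded ((\<lambda>x. c * f x) ` carrier G)"
    using bounded_scaling[OF l_RUC_bounded[OF f], of c] by (simp add: image_image)
  fix e :: real assume e: "0 < e"
  have "0 < e / (\<bar>c\<bar> + 1)" using e by simp
  from l_RUC_E[OF f this] obtain \<Theta> :: "nat \<Rightarrow> 'm list set" where
    \<Theta>: "\<And>k. definable M n (\<Theta> k)" "\<And>k. \<Theta> k \<subseteq> carrier G"
    "\<And>g. g \<in> carrier G \<Longrightarrow> \<exists>k. g \<in> \<Theta> k"
    "\<And>k g g' h. g \<in> \<Theta> k \<Longrightarrow> g' \<in> \<Theta> k \<Longrightarrow> h \<in> carrier G \<Longrightarrow>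
      \<bar>f (g \<otimes> h) - f (g' \<otimes> h)\<bar> < e / (\<bar>c\<bar> + 1)"
    by blast
  have "\<bar>c * f (g \<otimes> h) - c * f (g' \<otimes> h)\<bar> < e"
    if "g \<in> \<Theta> k" "g' \<in> \<Theta> k" "h \<in> carrier G" for k g g' h
  proof -
    have "\<bar>c * f (g \<otimes> h) - c * f (g' \<otimes> h)\<bar> = \<bar>c\<bar> * \<bar>f (g \<otimes> h) - f (g' \<otimes> h)\<bar>"
      by (simp add: abs_mult[symmetric] right_diff_distrib)
    also have "\<dots> \<le> \<bar>c\<bar> * (e / (\<bar>c\<bar> + 1))"
      using \<Theta>(4)[OF that] by (intro mult_left_mono) auto
    also have "\<dots> < e" using e by (simp add: field_simps)
    finally show ?thesis .
  qed
  with \<Theta>(1-3) show "\<exists>\<Theta> :: nat \<Rightarrow> 'm list set.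
      (\<forall>k. definable M n (\<Theta> k) \<and> \<Theta> k \<subseteq> carrier G) \<and> carrier G \<subseteq> (\<Union>k. \<Theta> k) \<and>
      (\<forall>k. \<forall>g\<in>\<Theta> k. \<forall>g'\<in>\<Theta> k. \<forall>h\<in>carrier G. \<bar>c * f (g \<otimes> h) - c * f (g' \<otimes> h)\<bar> < e)"
    by (intro exI[of _ \<Theta>]) auto
qed

lemma l_RUC_add:
  assumes f: "f \<in> l_RUC M n G" and f': "f' \<in> l_RUC M n G"
  shows "(\<lambda>x. f x + f' x) \<in> l_RUC M n G"
proof (rule l_RUC_I)
  show "bounded ((\<lambda>x. f x + f' x) ` carrier G)"
    using l_RUC_bounded[OF f] l_RUC_bounded[OF f'] by (rule bounded_plus_comp)
  fix e :: real assume "0 < e"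
  then have e2: "0 < e / 2" by simp
  from l_RUC_E[OF f e2] obtain \<Theta>1 :: "nat \<Rightarrow> 'm list set" where
    \<Theta>1: "\<And>k. definable M n (\<Theta>1 k)" "\<And>k. \<Theta>1 k \<subseteq> carrier G"
    "\<And>g. g \<in> carrier G \<Longrightarrow> \<exists>k. g \<in> \<Theta>1 k"
    "\<And>k g g' h. g \<in> \<Theta>1 k \<Longrightarrow> g' \<in> \<Theta>1 k \<Longrightarrow> h \<in> carrier G \<Longrightarrow> \<bar>f (g \<otimes> h) - f (g' \<otimes> h)\<bar> < e / 2"
    by blast
  from l_RUC_E[OF f' e2] obtain \<Theta>2 :: "nat \<Rightarrow> 'm list set" where
    \<Theta>2: "\<And>k. definable M n (\<Theta>2 k)" "\<And>k. \<Theta>2 k \<subseteq> carrier G"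
    "\<And>g. g \<in> carrier G \<Longrightarrow> \<exists>k. g \<in> \<Theta>2 k"
    "\<And>k g g' h. g \<in> \<Theta>2 k \<Longrightarrow> g' \<in> \<Theta>2 k \<Longrightarrow> h \<in> carrier G \<Longrightarrow> \<bar>f' (g \<otimes> h) - f' (g' \<otimes> h)\<bar> < e / 2"
    by blast
  define \<Theta> where "\<Theta> k = \<Theta>1 (fst (prod_decode k)) \<inter> \<Theta>2 (snd (prod_decode k))" for k
  have "\<bar>(f (g \<otimes> h) + f' (g \<otimes> h)) - (f (g' \<otimes> h) + f' (g' \<otimes> h))\<bar> < e"
    if "g \<in> \<Theta> k" "g' \<in> \<Theta> k" "h \<in> carrier G" for k g g' h
  proof -
    have "\<bar>f (g \<otimes> h) - f (g' \<otimes> h)\<bar> < e / 2" "\<bar>f' (g \<otimes> h) - f' (g' \<otimes> h)\<bar> < e / 2"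
      using \<Theta>1(4)[of g "fst (prod_decode k)" g' h] \<Theta>2(4)[of g "snd (prod_decode k)" g' h] that
      unfolding \<Theta>_def by blast+
    then show ?thesis by linarith
  qed
  moreover have "\<exists>k. g \<in> \<Theta> k" if g: "g \<in> carrier G" for g
  proof -
    obtain i j where "g \<in> \<Theta>1 i" "g \<in> \<Theta>2 j" using \<Theta>1(3)[OF g] \<Theta>2(3)[OF g] by blast
    then show ?thesis by (intro exI[of _ "prod_encode (i, j)"]) (simp add: \<Theta>_def)
  qed
  moreover have "definable M n (\<Theta> k)" "\<Theta> k \<subseteq> carrier G" for k
    using \<Theta>1(1,2) \<Theta>2(1) by (auto simp: \<Theta>_def intro: definable_Int)
  ultimately show "\<exists>\<Theta> :: nat \<Rightarrow> 'm list set.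
      (\<forall>k. definable M n (\<Theta> k) \<and> \<Theta> k \<subseteq> carrier G) \<and> carrier G \<subseteq> (\<Union>k. \<Theta> k) \<and>
      (\<forall>k. \<forall>g\<in>\<Theta> k. \<forall>g'\<in>\<Theta> k. \<forall>h\<in>carrier G.
        \<bar>(f (g \<otimes> h) + f' (g \<otimes> h)) - (f (g' \<otimes> h) + f' (g' \<otimes> h))\<bar> < e)"
    by (intro exI[of _ \<Theta>]) auto
qed

lemma l_RUC_translate:
  assumes f: "f \<in> l_RUC M n G" and a: "a \<in> carrier G"
  shows "(\<lambda>x. f (a \<otimes> x)) \<in> l_RUC M n G"
proof (rule l_RUC_I)
  show "bounded ((\<lambda>x. f (a \<otimes> x)) ` carrier G)"
    using a by (intro bounded_subset[OF l_RUC_bounded[OF f]]) auto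
  fix e :: real assume "0 < e"
  from l_RUC_E[OF f this] obtain \<Theta> :: "nat \<Rightarrow> 'm list set" where
    \<Theta>: "\<And>k. definable M n (\<Theta> k)" "\<And>k. \<Theta> k \<subseteq> carrier G"
    "\<And>g. g \<in> carrier G \<Longrightarrow> \<exists>k. g \<in> \<Theta> k"
    "\<And>k g g' h. g \<in> \<Theta> k \<Longrightarrow> g' \<in> \<Theta> k \<Longrightarrow> h \<in> carrier G \<Longrightarrow> \<bar>f (g \<otimes> h) - f (g' \<otimes> h)\<bar> < e"
    by blast
  define \<Theta>' where "\<Theta>' k = {x \<in> carrier G. a \<otimes> x \<in> \<Theta> k}" for k
  have "definable M n (\<Theta>' k)" for k
    unfolding \<Theta>'_def using definable_group \<Theta>(1) a by (rule definable_translate)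
  moreover have "\<exists>k. g \<in> \<Theta>' k" if "g \<in> carrier G" for g
    using \<Theta>(3)[of "a \<otimes> g"] a that by (simp add: \<Theta>'_def)
  moreover have "\<bar>f (a \<otimes> (g \<otimes> h)) - f (a \<otimes> (g' \<otimes> h))\<bar> < e"
    if "g \<in> \<Theta>' k" "g' \<in> \<Theta>' k" "h \<in> carrier G" for k g g' h
    using \<Theta>(4)[of "a \<otimes> g" k "a \<otimes> g'" h] that a by (simp add: \<Theta>'_def m_assoc)
  moreover have "\<Theta>' k \<subseteq> carrier G" for k by (auto simp: \<Theta>'_def)
  ultimately show "\<exists>\<Theta> :: nat \<Rightarrow> 'm list set.
      (\<forall>k. definable M n (\<Theta> k) \<and> \<Theta> k \<subseteq> carrier G) \<and> carrier G \<subseteq> (\<Union>k. \<Theta> k) \<and>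
      (\<forall>k. \<forall>g\<in>\<Theta> k. \<forall>g'\<in>\<Theta> k. \<forall>h\<in>carrier G. \<bar>f (a \<otimes> (g \<otimes> h)) - f (a \<otimes> (g' \<otimes> h))\<bar> < e)"
    by (intro exI[of _ \<Theta>']) auto
qed

lemma mean_add: "is_mean M n G m \<Longrightarrow> f \<in> l_RUC M n G \<Longrightarrow> f' \<in> l_RUC M n G \<Longrightarrow>
    m (\<lambda>x. f x + f' x) = m f + m f'"
  by (simp add: is_mean_def)

lemma mean_scale: "is_mean M n G m \<Longrightarrow> f \<in> l_RUC M n G \<Longrightarrow> m (\<lambda>x. c * f x) = c * m f"
  by (simp add: is_mean_def)

lemma mean_const:
  assumes "is_mean M n G m"
  shows "m (\<lambda>_. c) = c"
proof -
  have "(INF x\<in>carrier G. c) \<le> m (\<lambda>_. c) \<and> m (\<lambda>_. c) \<le> (SUP x\<in>carrier G. c)"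
    using assms l_RUC_const[of c] unfolding is_mean_def by blast
  then show ?thesis using carrier_nonempty by simp
qed

lemma mean_mono:
  assumes m: "is_mean M n G m" and f: "f \<in> l_RUC M n G" and f': "f' \<in> l_RUC M n G"
    and le: "\<And>x. x \<in> carrier G \<Longrightarrow> f x \<le> f' x"
  shows "m f \<le> m f'"
proof -
  have d: "(\<lambda>x. f' x + (-1) * f x) \<in> l_RUC M n G"
    using f' l_RUC_scale[OF f] by (rule l_RUC_add)
  have "0 \<le> (INF x\<in>carrier G. f' x + (-1) * f x)"
    using le carrier_nonempty by (intro cINF_greatest) auto
  also have "\<dots> \<le> m (\<lambda>x. f' x + (-1) * f x)"
    using m d unfolding is_mean_def by blast
  also have "\<dots> = m f' - m f"
    using mean_add[OF m f' l_RUC_scale[OF f, of "-1"]] mean_scale[OF m f, of "-1"] by simp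
  finally show ?thesis by simp
qed

text \<open>
  A translate \<open>x \<mapsto> f (a \<otimes> x)\<close> involves unspecified products for \<open>x\<close> outside the carrier, so that
  identities between translates hold on the carrier only.
\<close>

lemma mean_cong:
  assumes m: "is_mean M n G m" and f: "f \<in> l_RUC M n G"
    and eq: "\<And>x. x \<in> carrier G \<Longrightarrow> f x = f' x"
  shows "m f = m f'"
proof (rule antisym)
  have f': "f' \<in> l_RUC M n G" using f eq by (rule l_RUC_cong)
  show "m f \<le> m f'" using m f f' by (rule mean_mono) (simp add: eq)
  show "m f' \<le> m f" using m f' f by (rule mean_mono) (simp add: eq)
qed

lemma l_RUC_sum:
  assumes "\<And>i. i \<in> I \<Longrightarrow> f i \<in> l_RUC M n G"
  shows "(\<lambda>x. \<Sum>i\<in>I. f i x) \<in> l_RUC M n G"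
  using assms by (induction I rule: infinite_finite_induct) (simp_all add: l_RUC_const l_RUC_add)

lemma mean_sum:
  assumes "is_mean M n G m" "finite I" "\<And>i. i \<in> I \<Longrightarrow> f i \<in> l_RUC M n G"
  shows "m (\<lambda>x. \<Sum>i\<in>I. f i x) = (\<Sum>i\<in>I. m (f i))"
  using assms(2,3)
  by (induction I) (simp_all add: mean_const[OF assms(1)] mean_add[OF assms(1)] l_RUC_sum)

end

section \<open>Orbit functions of sigma-continuous actions\<close>

lemma sigma_topology_generated:
  assumes "\<F> \<subseteq> Pow X"
  shows "sigma_topology X (generated_sigma_topology X \<F>)"
proof -
  have "sigma_topology X (Pow X)" by (auto simp: sigma_topology_def)
  with assms have "generated_sigma_topology X \<F> \<subseteq> Pow X"
    unfolding generated_sigma_topology_def by blast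
  moreover have "\<Union>\<U> \<in> generated_sigma_topology X \<F>"
    if "countable \<U>" "\<U> \<subseteq> generated_sigma_topology X \<F>" for \<U>
  proof -
    have "\<Union>\<U> \<in> \<Sigma>" if "sigma_topology X \<Sigma>" "\<F> \<subseteq> \<Sigma>" for \<Sigma>
    proof -
      have "\<U> \<subseteq> \<Sigma>" using \<open>\<U> \<subseteq> _\<close> that unfolding generated_sigma_topology_def by blast
      with that(1) \<open>countable \<U>\<close> show ?thesis unfolding sigma_topology_def by blast
    qed
    then show ?thesis unfolding generated_sigma_topology_def by blast
  qed
  ultimately show ?thesis
    unfolding sigma_topology_def[of X "generated_sigma_topology X \<F>"]
    by (auto simp: generated_sigma_topology_def sigma_topology_def)
qed

lemma sigma_topology_Union:
  "sigma_topology X \<Sigma> \<Longrightarrow> countable \<U> \<Longrightarrow> \<U> \<subseteq> \<Sigma> \<Longrightarrow> \<Union>\<U> \<in> \<Sigma>"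
  by (simp add: sigma_topology_def)

lemma generated_sigma_topology_least:
  "sigma_topology X \<Sigma> \<Longrightarrow> \<F> \<subseteq> \<Sigma> \<Longrightarrow> generated_sigma_topology X \<F> \<subseteq> \<Sigma>"
  unfolding generated_sigma_topology_def by blast

lemma generated_sigma_topology_base: "\<F> \<subseteq> generated_sigma_topology X \<F>"
  unfolding generated_sigma_topology_def by blast

lemma is_basis_iff:
  "is_basis X \<B> \<longleftrightarrow> (\<forall>B\<in>\<B>. openin X B) \<and>
    (\<forall>U x. openin X U \<and> x \<in> U \<longrightarrow> (\<exists>B\<in>\<B>. x \<in> B \<and> B \<subseteq> U))"
  unfolding is_basis_def openin_topology_base_unique by blast

lemma sigma_open_imp_open:
  assumes "is_basis X \<B>" "U \<in> generated_sigma_topology (topspace X) \<B>"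
  shows "openin X U"
proof -
  have "sigma_topology (topspace X) (Collect (openin X))"
    using openin_subset by (auto simp: sigma_topology_def)
  from generated_sigma_topology_least[OF this] assms show ?thesis
    by (auto simp: is_basis_iff)
qed

lemma sigma_open_imp_sigma_sets:
  assumes "\<B> \<subseteq> Pow X" "U \<in> generated_sigma_topology X \<B>"
  shows "U \<in> sigma_sets X \<B>"
proof -
  interpret sigma_algebra X "sigma_sets X \<B>" by (rule sigma_algebra_sigma_sets[OF assms(1)])
  have "sigma_topology X (sigma_sets X \<B>)"
    using sets_into_space by (auto simp: sigma_topology_def intro: countable_Union)
  from generated_sigma_topology_least[OF this] assms(2) show ?thesis
    by (auto intro: sigma_sets.Basic)
qed

context definable_group_on
begin

text \<open>
  Countable unions of rectangles \<open>D \<times> E\<close>, with \<open>D\<close> definable and \<open>E\<close> sigma-open, are closed under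
  finite intersections and countable unions, so every sigma-open subset of the product has this form.
  It gives both the sigma-open sections and, for each point, a definable set of group elements on which
  the action can be controlled.
\<close>

lemma sigma_open_rectangles:
  assumes \<B>: "\<B> \<subseteq> Pow X"
    and W: "W \<in> generated_sigma_topology (carrier G \<times> X)
      {D \<times> B | D B. definable M n D \<and> D \<subseteq> carrier G \<and> B \<in> \<B>}"
  obtains D E where "\<And>k::nat. definable M n (D k)" "\<And>k. D k \<subseteq> carrier G"
    "\<And>k. E k \<in> generated_sigma_topology X \<B>" "W = (\<Union>k. D k \<times> E k)"
proof -
  define \<Sigma> where "\<Sigma> = generated_sigma_topology X \<B>"
  note \<Sigma> = sigma_topology_generated[OF \<B>, folded \<Sigma>_def]
  define good where "good D E \<longleftrightarrow> (\<forall>k::nat. definable M n (D k) \<and> D k \<subseteq> carrier G \<and> E k \<in> \<Sigma>)" for D E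
  define R where "R = {W. \<exists>D E. good D E \<and> W = (\<Union>k. D k \<times> E k)}"
  have RI: "(\<Union>k. D k \<times> E k) \<in> R" if "good D E" for D E using that unfolding R_def by blast
  have single: "D \<times> E \<in> R" if "definable M n D" "D \<subseteq> carrier G" "E \<in> \<Sigma>" for D E
    using RI[of "\<lambda>_. D" "\<lambda>_. E"] that by (simp add: good_def)
  have empty: "{} \<in> R"
    using single[of "carrier G" "{}"] \<Sigma> carrier_definable by (simp add: sigma_topology_def)
  have "sigma_topology (carrier G \<times> X) R"
    unfolding sigma_topology_def
  proof (intro conjI ballI allI impI)
    show "R \<subseteq> Pow (carrier G \<times> X)"
      using \<Sigma> by (fastforce simp: R_def good_def sigma_topology_def)
    show "{} \<in> R" by (rule empty)
    show "carrier G \<times> X \<in> R"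
      using \<Sigma> carrier_definable by (intro single) (simp_all add: sigma_topology_def)
  next
    fix U V assume "U \<in> R" "V \<in> R"
    then obtain D E D' E' where
      U: "good D E" "U = (\<Union>k. D k \<times> E k)" and V: "good D' E'" "V = (\<Union>k. D' k \<times> E' k)"
      unfolding R_def by blast
    define F where "F k = D (fst (prod_decode k)) \<inter> D' (snd (prod_decode k))" for k
    define H where "H k = E (fst (prod_decode k)) \<inter> E' (snd (prod_decode k))" for k
    have "good F H"
      using U(1) V(1) \<Sigma> unfolding good_def F_def H_def
      by (intro allI conjI definable_Int) (auto simp: sigma_topology_def)
    moreover have "U \<inter> V = (\<Union>k. F k \<times> H k)"
    proof (intro equalityI subsetI)
      fix z assume "z \<in> U \<inter> V"
      then obtain i j where "z \<in> D i \<times> E i" "z \<in> D' j \<times> E' j" unfolding U(2) V(2) by blast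
      then have "z \<in> F (prod_encode (i, j)) \<times> H (prod_encode (i, j))" by (auto simp: F_def H_def)
      then show "z \<in> (\<Union>k. F k \<times> H k)" by blast
    qed (auto simp: U(2) V(2) F_def H_def)
    ultimately show "U \<inter> V \<in> R" using RI by simp
  next
    fix \<U> assume "countable \<U> \<and> \<U> \<subseteq> R"
    show "\<Union>\<U> \<in> R"
    proof (cases "\<U> = {}")
      case True
      with empty show ?thesis by simp
    next
      case False
      define U where "U = from_nat_into \<U>"
      have U: "range U = \<U>" unfolding U_def
        using False \<open>countable \<U> \<and> \<U> \<subseteq> R\<close> by (intro range_from_nat_into) auto
      then have "U i \<in> R" for i using \<open>countable \<U> \<and> \<U> \<subseteq> R\<close> by blast
      then have "\<forall>i. \<exists>D E. good D E \<and> U i = (\<Union>k. D k \<times> E k)" unfolding R_def by blast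
      then obtain D E where *: "\<forall>i. good (D i) (E i) \<and> U i = (\<Union>k. D i k \<times> E i k)"
        unfolding choice_iff by blast
      have DE: "good (D i) (E i)" "U i = (\<Union>k. D i k \<times> E i k)" for i
        using spec[OF *, of i] by simp_all
      define F where "F k = D (fst (prod_decode k)) (snd (prod_decode k))" for k
      define H where "H k = E (fst (prod_decode k)) (snd (prod_decode k))" for k
      have "good F H" using DE(1) by (simp add: good_def F_def H_def)
      moreover have "\<Union>\<U> = (\<Union>k. F k \<times> H k)"
      proof (intro equalityI subsetI)
        fix z assume "z \<in> \<Union>\<U>"
        then obtain i where "z \<in> U i" unfolding U[symmetric] by blast
        then obtain j where "z \<in> D i j \<times> E i j" unfolding DE(2) by blast
        then have "z \<in> F (prod_encode (i, j)) \<times> H (prod_encode (i, j))" by (auto simp: F_def H_def)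
        then show "z \<in> (\<Union>k. F k \<times> H k)" by blast
      next
        fix z assume "z \<in> (\<Union>k. F k \<times> H k)"
        then obtain k where "z \<in> F k \<times> H k" by blast
        then have "z \<in> U (fst (prod_decode k))" unfolding DE(2) F_def H_def by blast
        then show "z \<in> \<Union>\<U>" using U by blast
      qed
      ultimately show ?thesis using RI by simp
    qed
  qed
  moreover have "{D \<times> B | D B. definable M n D \<and> D \<subseteq> carrier G \<and> B \<in> \<B>} \<subseteq> R"
  proof
    fix Z assume "Z \<in> {D \<times> B | D B. definable M n D \<and> D \<subseteq> carrier G \<and> B \<in> \<B>}"
    then obtain D B where "Z = D \<times> B" "definable M n D" "D \<subseteq> carrier G" "B \<in> \<B>" by blast
    moreover have "\<B> \<subseteq> \<Sigma>" unfolding \<Sigma>_def by (rule generated_sigma_topology_base)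
    ultimately show "Z \<in> R" using single[of D B] by (simp add: subset_iff)
  qed
  ultimately have "W \<in> R"
    using W by (rule generated_sigma_topology_least[THEN subsetD])
  then obtain D E where DE: "good D E" "W = (\<Union>k. D k \<times> E k)" unfolding R_def by blast
  show thesis
    using DE(1) DE(2) unfolding good_def \<Sigma>_def by (intro that[of D E]) simp_all
qed

context
  fixes X :: "'x topology" and \<B> :: "'x set set" and \<phi> :: "'m list \<Rightarrow> 'x \<Rightarrow> 'x"
  assumes basis: "is_basis X \<B>" and act: "sigma_continuous_action M n G X \<B> \<phi>"
begin

lemma group_action: "group_action G (topspace X) \<phi>"
  using act by (simp add: sigma_continuous_action_def)

lemma act_in_topspace: "g \<in> carrier G \<Longrightarrow> x \<in> topspace X \<Longrightarrow> \<phi> g x \<in> topspace X"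
  using group_action.element_image[OF group_action] by blast

lemma act_mult: "g \<in> carrier G \<Longrightarrow> h \<in> carrier G \<Longrightarrow> x \<in> topspace X \<Longrightarrow> \<phi> (g \<otimes> h) x = \<phi> g (\<phi> h x)"
  using group_action.composition_rule[OF group_action] by blast

lemma act_one: "x \<in> topspace X \<Longrightarrow> \<phi> \<one> x = x"
  using group_action.id_eq_one[OF group_action] by (metis restrict_apply')

lemma basis_subset: "\<B> \<subseteq> Pow (topspace X)"
  using basis openin_subset by (auto simp: is_basis_iff)

lemma act_preimage_rectangles:
  assumes "B \<in> \<B>"
  obtains D E where "\<And>k::nat. definable M n (D k)" "\<And>k. D k \<subseteq> carrier G"
    "\<And>k. E k \<in> generated_sigma_topology (topspace X) \<B>"
    "\<And>g x. g \<in> carrier G \<Longrightarrow> x \<in> topspace X \<Longrightarrow> \<phi> g x \<in> B \<longleftrightarrow> (\<exists>k. g \<in> D k \<and> x \<in> E k)"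
proof -
  have "B \<in> generated_sigma_topology (topspace X) \<B>"
    using assms generated_sigma_topology_base by blast
  then have "{z \<in> carrier G \<times> topspace X. (\<lambda>(g, x). \<phi> g x) z \<in> B} \<in>
      generated_sigma_topology (carrier G \<times> topspace X)
        {D \<times> B | D B. definable M n D \<and> D \<subseteq> carrier G \<and> B \<in> \<B>}"
    using act by (simp only: sigma_continuous_action_def sigma_continuous_def)
  from sigma_open_rectangles[OF basis_subset this] obtain D E where DE:
    "\<And>k::nat. definable M n (D k)" "\<And>k. D k \<subseteq> carrier G"
    "\<And>k. E k \<in> generated_sigma_topology (topspace X) \<B>"
    "{z \<in> carrier G \<times> topspace X. (\<lambda>(g, x). \<phi> g x) z \<in> B} = (\<Union>k. D k \<times> E k)"
    by blast
  from DE(4) have "\<phi> g x \<in> B \<longleftrightarrow> (\<exists>k. g \<in> D k \<and> x \<in> E k)"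
    if "g \<in> carrier G" "x \<in> topspace X" for g x
    using that by (auto simp: set_eq_iff)
  with DE(1-3) show thesis by (rule that)
qed

lemma act_preimage_sigma_open:
  assumes g: "g \<in> carrier G" and B: "B \<in> \<B>"
  shows "{x \<in> topspace X. \<phi> g x \<in> B} \<in> generated_sigma_topology (topspace X) \<B>"
proof -
  note \<Sigma> = sigma_topology_generated[OF basis_subset]
  obtain D E where DE: "\<And>k::nat. definable M n (D k)" "\<And>k. D k \<subseteq> carrier G"
    "\<And>k. E k \<in> generated_sigma_topology (topspace X) \<B>"
    "\<And>g x. g \<in> carrier G \<Longrightarrow> x \<in> topspace X \<Longrightarrow> \<phi> g x \<in> B \<longleftrightarrow> (\<exists>k. g \<in> D k \<and> x \<in> E k)"
    using act_preimage_rectangles[OF B] by blast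
  have "E k \<subseteq> topspace X" for k
    using \<Sigma> DE(3)[of k] by (auto simp: sigma_topology_def)
  then have "{x \<in> topspace X. \<phi> g x \<in> B} = \<Union> (E ` {k. g \<in> D k})"
    using DE(4)[OF g] by (auto simp: subset_iff)
  moreover have "\<Union> (E ` {k. g \<in> D k}) \<in> generated_sigma_topology (topspace X) \<B>"
    using DE(3) by (intro sigma_topology_Union[OF \<Sigma>]) auto
  ultimately show ?thesis by simp
qed

lemma act_continuous:
  assumes g: "g \<in> carrier G"
  shows "continuous_map X X (\<phi> g)"
  unfolding continuous_map_def
proof (intro conjI allI impI)
  show "\<phi> g \<in> topspace X \<rightarrow> topspace X" using act_in_topspace[OF g] by blast
  fix U assume U: "openin X U"
  show "openin X {x \<in> topspace X. \<phi> g x \<in> U}"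
  proof (subst openin_subopen, intro ballI)
    fix x assume x: "x \<in> {x \<in> topspace X. \<phi> g x \<in> U}"
    then obtain B where B: "B \<in> \<B>" "\<phi> g x \<in> B" "B \<subseteq> U"
      using basis U unfolding is_basis_iff by blast
    have "openin X {x \<in> topspace X. \<phi> g x \<in> B}"
      using sigma_open_imp_open[OF basis act_preimage_sigma_open[OF g B(1)]] .
    then show "\<exists>T. openin X T \<and> x \<in> T \<and> T \<subseteq> {x \<in> topspace X. \<phi> g x \<in> U}"
      using x B by (intro exI[of _ "{x \<in> topspace X. \<phi> g x \<in> B}"]) auto
  qed
qed

lemma act_preimage_sigma_sets:
  assumes g: "g \<in> carrier G" and A: "A \<in> sigma_sets (topspace X) \<B>"
  shows "{x \<in> topspace X. \<phi> g x \<in> A} \<in> sigma_sets (topspace X) \<B>"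
  using A
proof (induction A)
  case (Basic B)
  then show ?case
    using sigma_open_imp_sigma_sets[OF basis_subset act_preimage_sigma_open[OF g]] by blast
next
  case Empty
  then show ?case by (simp add: sigma_sets.Empty)
next
  case (Compl A)
  have "{x \<in> topspace X. \<phi> g x \<in> topspace X - A} = topspace X - {x \<in> topspace X. \<phi> g x \<in> A}"
    using act_in_topspace[OF g] by auto
  with sigma_sets.Compl[OF Compl.IH] show ?case by simp
next
  case (Union A)
  have "{x \<in> topspace X. \<phi> g x \<in> (\<Union>i. A i)} = (\<Union>i. {x \<in> topspace X. \<phi> g x \<in> A i})" by auto
  with sigma_sets.Union[OF Union.IH] show ?case by simp
qed

text \<open>
  Cover \<open>X\<close> by finitely many basic sets \<open>B\<close> on which \<open>F\<close> oscillates by less than \<open>e\<close>.  The condition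
  \<open>\<phi> g x \<in> B\<close> is a countable union of rectangles \<open>D \<times> E\<close>.  For fixed \<open>g\<close>, the sets \<open>E\<close> of the
  rectangles with \<open>g \<in> D\<close> cover \<open>X\<close>, so finitely many do.  The intersection of the corresponding sets \<open>D\<close>
  is definable and contains \<open>g\<close>, and two of its elements move each point of \<open>X\<close> into a common \<open>B\<close>.  There
  are only countably many finite families of rectangles, and the estimate holds at every point of \<open>X\<close>,
  in particular at all translates \<open>\<phi> h x0\<close>.
\<close>

theorem orbit_function_l_RUC:
  assumes compact: "compact_space X" and F: "continuous_map X euclideanreal F"
    and x0: "x0 \<in> topspace X"
  shows "(\<lambda>g. F (\<phi> g x0)) \<in> l_RUC M n G"
proof (rule l_RUC_I)
  have "compactin euclideanreal (F ` topspace X)"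
    using image_compactin[OF _ F] compact by (simp add: compact_space_def)
  then have "bounded (F ` topspace X)" by (simp add: compact_imp_bounded)
  then show "bounded ((\<lambda>g. F (\<phi> g x0)) ` carrier G)"
    using act_in_topspace x0 by (elim bounded_subset) auto
  fix e :: real assume e: "0 < e"
  define small where "small = {B \<in> \<B>. \<forall>y\<in>B. \<forall>z\<in>B. \<bar>F y - F z\<bar> < e}"
  have "\<exists>B\<in>small. y \<in> B" if y: "y \<in> topspace X" for y
  proof -
    have "openin X {z \<in> topspace X. F z \<in> ball (F y) (e / 2)}"
      by (rule openin_continuous_map_preimage[OF F]) simp
    moreover have "y \<in> {z \<in> topspace X. F z \<in> ball (F y) (e / 2)}" using y e by simp
    ultimately obtain B where B: "B \<in> \<B>" "y \<in> B" "B \<subseteq> {z \<in> topspace X. F z \<in> ball (F y) (e / 2)}"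
      using basis unfolding is_basis_iff by meson
    have near: "\<bar>F y - F z\<bar> < e / 2" if "z \<in> B" for z
      using that B(3) by (auto simp: dist_real_def)
    have "\<bar>F u - F z\<bar> < e" if "u \<in> B" "z \<in> B" for u z
      using near[OF that(1)] near[OF that(2)] by linarith
    with B show ?thesis by (auto simp: small_def)
  qed
  moreover have small_open: "\<forall>B\<in>small. openin X B"
    using basis by (simp add: small_def is_basis_iff)
  moreover have "topspace X \<subseteq> \<Union>small" using calculation(1) by auto
  ultimately obtain \<B>0 where \<B>0: "finite \<B>0" "\<B>0 \<subseteq> small" "topspace X \<subseteq> \<Union>\<B>0"
    using compactinD[OF compact[unfolded compact_space_def], of small] by metis
  define rep where "rep B D E \<longleftrightarrow> (\<forall>k::nat. definable M n (D k) \<and> openin X (E k)) \<and>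
      (\<forall>g\<in>carrier G. \<forall>x\<in>topspace X. \<phi> g x \<in> B \<longleftrightarrow> (\<exists>k. g \<in> D k \<and> x \<in> E k))" for B D E
  have "\<forall>B\<in>\<B>0. \<exists>D E. rep B D E"
  proof
    fix B assume "B \<in> \<B>0"
    then have "B \<in> \<B>" using \<B>0(2) by (auto simp: small_def)
    then obtain D E where *: "\<And>k::nat. definable M n (D k)" "\<And>k. D k \<subseteq> carrier G"
      "\<And>k. E k \<in> generated_sigma_topology (topspace X) \<B>"
      "\<And>g x. g \<in> carrier G \<Longrightarrow> x \<in> topspace X \<Longrightarrow> \<phi> g x \<in> B \<longleftrightarrow> (\<exists>k. g \<in> D k \<and> x \<in> E k)"
      using act_preimage_rectangles by blast
    have "rep B D E"
      unfolding rep_def using *(1,4) sigma_open_imp_open[OF basis *(3)] by simp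
    then show "\<exists>D E. rep B D E" by blast
  qed
  then obtain D E where rep: "\<And>B. B \<in> \<B>0 \<Longrightarrow> rep B (D B) (E B)"
    unfolding bchoice_iff by blast
  have DE: "definable M n (D B k)" "openin X (E B k)" if "B \<in> \<B>0" for B k
    using rep[OF that] by (simp_all add: rep_def)
  have cover: "\<phi> g x \<in> B \<longleftrightarrow> (\<exists>k. g \<in> D B k \<and> x \<in> E B k)"
    if "B \<in> \<B>0" "g \<in> carrier G" "x \<in> topspace X" for B g x
    using rep[OF that(1)] that(2,3) by (simp add: rep_def)
  \<comment> \<open>the finite families of rectangles whose second sides cover the space\<close>
  define \<J> where "\<J> = {J. finite J \<and> J \<subseteq> \<B>0 \<times> UNIV \<and> topspace X \<subseteq> (\<Union>(B, k)\<in>J. E B k)}"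
  define \<Theta> where "\<Theta> J = carrier G \<inter> (\<Inter>j\<in>J. D (fst j) (snd j))" for J
  have "countable {J. finite J \<and> J \<subseteq> \<B>0 \<times> (UNIV :: nat set)}"
    using \<B>0(1) by (intro countable_Collect_finite_subset countable_SIGMA) (auto intro: countable_finite)
  then have "countable \<J>"
    by (rule countable_subset[rotated]) (auto simp: \<J>_def)
  have \<Theta>_cover: "\<exists>J\<in>\<J>. g \<in> \<Theta> J" if g: "g \<in> carrier G" for g
  proof -
    define I where "I = {(B, k). B \<in> \<B>0 \<and> g \<in> D B k}"
    define h where "h j = E (fst j) (snd j)" for j
    have "topspace X \<subseteq> \<Union> (h ` I)"
    proof
      fix x assume x: "x \<in> topspace X"
      then obtain B where "B \<in> \<B>0" "\<phi> g x \<in> B" using \<B>0(3) act_in_topspace[OF g x] by blast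
      with cover[OF this(1) g x] obtain k where "g \<in> D B k" "x \<in> E B k" by blast
      with \<open>B \<in> \<B>0\<close> have "(B, k) \<in> I" "x \<in> h (B, k)" by (auto simp: I_def h_def)
      then show "x \<in> \<Union> (h ` I)" by blast
    qed
    moreover have "\<forall>U\<in>h ` I. openin X U" using DE(2) by (auto simp: I_def h_def)
    ultimately obtain \<F> where \<F>: "finite \<F>" "\<F> \<subseteq> h ` I" "topspace X \<subseteq> \<Union> \<F>"
      using compactinD[OF compact[unfolded compact_space_def], of "h ` I"] by blast
    then obtain J where J: "J \<subseteq> I" "finite J" "\<F> = h ` J" by (metis finite_subset_image)
    have "J \<in> \<J>"
      using J \<F>(3) by (auto simp: \<J>_def I_def h_def case_prod_unfold)
    moreover have "g \<in> \<Theta> J" using J g by (auto simp: \<Theta>_def I_def)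
    ultimately show ?thesis by blast
  qed
  then have "\<J> \<noteq> {}" using one_closed by blast
  define \<Theta>' where "\<Theta>' k = \<Theta> (from_nat_into \<J> k)" for k
  have in_\<J>: "from_nat_into \<J> k \<in> \<J>" for k using \<open>\<J> \<noteq> {}\<close> by (rule from_nat_into)
  have "definable M n (\<Theta> J)" if "J \<in> \<J>" for J
    unfolding \<Theta>_def using that DE(1) carrier_definable
    by (intro definable_Inter) (auto simp: \<J>_def)
  then have "definable M n (\<Theta>' k)" for k using in_\<J> by (simp add: \<Theta>'_def)
  moreover have "\<Theta>' k \<subseteq> carrier G" for k by (auto simp: \<Theta>'_def \<Theta>_def)
  moreover have "\<exists>k. g \<in> \<Theta>' k" if "g \<in> carrier G" for g
    using \<Theta>_cover[OF that] from_nat_into_surj[OF \<open>countable \<J>\<close>] unfolding \<Theta>'_def by metis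
  moreover have "\<bar>F (\<phi> (g \<otimes> h) x0) - F (\<phi> (g' \<otimes> h) x0)\<bar> < e"
    if g: "g \<in> \<Theta>' k" and g': "g' \<in> \<Theta>' k" and h: "h \<in> carrier G" for k g g' h
  proof -
    define x where "x = \<phi> h x0"
    define J where "J = from_nat_into \<J> k"
    have gG: "g \<in> carrier G" "g' \<in> carrier G" using g g' by (auto simp: \<Theta>'_def \<Theta>_def)
    have x: "x \<in> topspace X" using act_in_topspace[OF h x0] by (simp add: x_def)
    have "J \<in> \<J>" using in_\<J> by (simp add: J_def)
    then obtain B k where Bk: "(B, k) \<in> J" "x \<in> E B k" "B \<in> \<B>0"
      using x unfolding \<J>_def by blast
    have "g \<in> D B k" "g' \<in> D B k"
      using g g' Bk(1) by (force simp: \<Theta>'_def \<Theta>_def J_def)+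
    then have "\<phi> g x \<in> B" "\<phi> g' x \<in> B" using cover[OF Bk(3) _ x] gG Bk(2) by blast+
    then have "\<bar>F (\<phi> g x) - F (\<phi> g' x)\<bar> < e" using Bk(3) \<B>0(2) by (auto simp: small_def)
    then show ?thesis using act_mult gG h x0 by (simp add: x_def)
  qed
  ultimately show "\<exists>\<Theta> :: nat \<Rightarrow> 'm list set.
      (\<forall>k. definable M n (\<Theta> k) \<and> \<Theta> k \<subseteq> carrier G) \<and> carrier G \<subseteq> (\<Union>k. \<Theta> k) \<and>
      (\<forall>k. \<forall>g\<in>\<Theta> k. \<forall>g'\<in>\<Theta> k. \<forall>h\<in>carrier G. \<bar>F (\<phi> (g \<otimes> h) x0) - F (\<phi> (g' \<otimes> h) x0)\<bar> < e)"
    by (intro exI[of _ \<Theta>']) auto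
qed

end

end

section \<open>Averaging along orbits\<close>

context definable_group_on
begin

text \<open>
  The translate by \<open>a\<close> of the orbit function of \<open>F\<close> is the orbit function of \<open>F \<circ> \<phi> a\<close>, which is again
  continuous.
\<close>

lemma mean_orbit_invariant:
  assumes m: "is_mean M n G m" and inv: "left_invariant M n G m"
    and basis: "is_basis X \<B>" and act: "sigma_continuous_action M n G X \<B> \<phi>"
    and compact: "compact_space X" and x0: "x0 \<in> topspace X"
    and F: "continuous_map X euclideanreal F" and a: "a \<in> carrier G"
  shows "m (\<lambda>g. F (\<phi> a (\<phi> g x0))) = m (\<lambda>g. F (\<phi> g x0))"
proof -
  have "continuous_map X euclideanreal (\<lambda>x. F (\<phi> a x))"
    using continuous_map_compose[OF act_continuous[OF basis act a] F] by (simp add: o_def)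
  then have "(\<lambda>g. F (\<phi> a (\<phi> g x0))) \<in> l_RUC M n G"
    using orbit_function_l_RUC[OF basis act compact _ x0] by blast
  then have "m (\<lambda>g. F (\<phi> a (\<phi> g x0))) = m (\<lambda>g. F (\<phi> (a \<otimes> g) x0))"
    by (rule mean_cong[OF m]) (simp add: act_mult[OF basis act a] x0)
  also have "\<dots> = m (\<lambda>g. F (\<phi> g x0))"
    using inv[unfolded left_invariant_def, rule_format, OF a orbit_function_l_RUC[OF basis act compact F x0]]
    by simp
  finally show ?thesis .
qed

text \<open>
  The mean along an orbit is a positive normalized functional on the continuous functions, and each \<open>\<phi> g\<close>
  is a homeomorphism that preserves it.
\<close>

theorem invariant_measure_of_mean:
  assumes m: "is_mean M n G m" and inv: "left_invariant M n G m"
    and nonempty: "topspace X \<noteq> {}" and compact: "compact_space X" and Haus: "Hausdorff_space X"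
    and basis: "is_basis X \<B>" and act: "sigma_continuous_action M n G X \<B> \<phi>"
  obtains \<mu> where "space \<mu> = topspace X" "sets \<mu> = sigma_sets (topspace X) \<B>" "prob_space \<mu>"
    "\<And>g A. g \<in> carrier G \<Longrightarrow> A \<in> sets \<mu> \<Longrightarrow>
      emeasure \<mu> {x \<in> topspace X. \<phi> g x \<in> A} = emeasure \<mu> A"
proof -
  obtain x0 where x0: "x0 \<in> topspace X" using nonempty by blast
  define \<Lambda> where "\<Lambda> F = m (\<lambda>g. F (\<phi> g x0))" for F
  note orbit = orbit_function_l_RUC[OF basis act compact _ x0]
  interpret Riesz: normalized_positive_functional X \<Lambda>
  proof
    fix f g assume "continuous_map X euclideanreal f" "continuous_map X euclideanreal g"
      "\<And>x. x \<in> topspace X \<Longrightarrow> f x \<le> g x"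
    then show "\<Lambda> f \<le> \<Lambda> g"
      unfolding \<Lambda>_def using orbit act_in_topspace[OF basis act _ x0] by (intro mean_mono[OF m]) blast+
  next
    fix f g assume "continuous_map X euclideanreal f" "continuous_map X euclideanreal g"
    then show "\<Lambda> (\<lambda>x. f x + g x) = \<Lambda> f + \<Lambda> g"
      unfolding \<Lambda>_def using orbit by (intro mean_add[OF m]) blast+
  next
    show "\<Lambda> (\<lambda>_. c) = c" for c
      unfolding \<Lambda>_def by (rule mean_const[OF m])
  qed (fact compact Haus)+
  have \<Lambda>_inv: "\<Lambda> (\<lambda>x. F (\<phi> a x)) = \<Lambda> F"
    if "a \<in> carrier G" "continuous_map X euclideanreal F" for a F
    unfolding \<Lambda>_def using mean_orbit_invariant[OF m inv basis act compact x0 that(2,1)] .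
  define \<mu> where "\<mu> = measure_of (topspace X) \<B> Riesz.outer_mass"
  have \<B>: "\<B> \<subseteq> Collect (openin X)" using basis by (auto simp: is_basis_iff)
  note \<mu> = Riesz.outer_mass_measure[OF \<B>, folded \<mu>_def]
  have "emeasure \<mu> {x \<in> topspace X. \<phi> g x \<in> A} = emeasure \<mu> A"
    if g: "g \<in> carrier G" and A: "A \<in> sets \<mu>" for g A
  proof -
    have inv_g: "inv g \<in> carrier G" using g by simp
    have "Riesz.outer_mass {x \<in> topspace X. \<phi> g x \<in> A} = Riesz.outer_mass A"
    proof (rule Riesz.outer_mass_vimage[where S = "\<phi> (inv g)"])
      show "continuous_map X X (\<phi> g)" "continuous_map X X (\<phi> (inv g))"
        using act_continuous[OF basis act] g inv_g by blast+
      show "\<phi> (inv g) (\<phi> g x) = x" "\<phi> g (\<phi> (inv g) x) = x" if "x \<in> topspace X" for x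
        using act_mult[OF basis act _ _ that, of "inv g" g] act_mult[OF basis act _ _ that, of g "inv g"]
          act_one[OF basis act that] g inv_g by simp_all
      show "A \<subseteq> topspace X" using sets.sets_into_space[OF A] \<mu>(1) by simp
    qed (use \<Lambda>_inv g inv_g in blast)+
    moreover have "{x \<in> topspace X. \<phi> g x \<in> A} \<in> sets \<mu>"
      using act_preimage_sigma_sets[OF basis act g] A \<mu>(2) by simp
    ultimately show ?thesis using A by (simp add: \<mu>(3))
  qed
  with \<mu>(1,2,4) show thesis by (rule that)
qed

text \<open>
  Finitely many affine functions \<open>F\<close> take the values \<open>b F = m (\<lambda>g. F (\<phi> g x0))\<close> simultaneously.  Let \<open>c\<close>
  minimize the sum of the squares \<open>(F x - b F)\<^sup>2\<close>, and let \<open>a F = F c - b F\<close> be the errors at \<open>c\<close>.  Moving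
  from \<open>c\<close> towards another point of \<open>C\<close> does not decrease the sum, so \<open>H = \<Sum> a F * F\<close> is minimal at
  \<open>c\<close>.  Hence the mean \<open>\<Sum> a F * b F\<close> of \<open>H\<close> along the orbit is at least \<open>H c\<close>, that is, the sum of the
  squares of the errors is at most \<open>0\<close>.
\<close>

lemma barycenter_finite:
  fixes X :: "'v::real_vector topology"
  assumes m: "is_mean M n G m"
    and C: "C \<noteq> {}" "convex C" and X: "topspace X = C" "compact_space X"
    and basis: "is_basis X \<B>" and act: "sigma_continuous_action M n G X \<B> \<phi>" and x0: "x0 \<in> C"
    and I: "finite I" and cont: "\<And>F. F \<in> I \<Longrightarrow> continuous_map X euclideanreal F"
    and affine: "\<And>F x y t. F \<in> I \<Longrightarrow> x \<in> C \<Longrightarrow> y \<in> C \<Longrightarrow> t \<in> {0..1} \<Longrightarrow>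
      F ((1 - t) *\<^sub>R x + t *\<^sub>R y) = (1 - t) * F x + t * F y"
  shows "\<exists>c\<in>C. \<forall>F\<in>I. F c = m (\<lambda>g. F (\<phi> g x0))"
proof -
  note orbit = orbit_function_l_RUC[OF basis act X(2) _ x0[folded X(1)]]
  define b where "b F = m (\<lambda>g. F (\<phi> g x0))" for F :: "'v \<Rightarrow> real"
  define Q where "Q x = (\<Sum>F\<in>I. (F x - b F)\<^sup>2)" for x
  have "continuous_map X euclideanreal Q"
    unfolding Q_def using cont I
    by (intro continuous_map_sum continuous_map_real_pow continuous_map_diff continuous_map_const[THEN iffD2])
      auto
  then have "compact (Q ` C)"
    using image_compactin[of X C euclideanreal Q] X by (simp add: compact_space_def)
  from compact_attains_inf[OF this] C(1) obtain c where c: "c \<in> C" "\<And>x. x \<in> C \<Longrightarrow> Q c \<le> Q x"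
    by blast
  define a where "a F = F c - b F" for F
  have variation: "0 \<le> (\<Sum>F\<in>I. a F * (F x - F c))" if x: "x \<in> C" for x
  proof (rule ccontr)
    define S where "S = (\<Sum>F\<in>I. a F * (F x - F c))"
    define R where "R = (\<Sum>F\<in>I. (F x - F c)\<^sup>2)"
    assume "\<not> 0 \<le> (\<Sum>F\<in>I. a F * (F x - F c))"
    then have S: "S < 0" by (simp add: S_def)
    have R: "0 \<le> R" by (simp add: R_def sum_nonneg)
    \<comment> \<open>small enough that the quadratic term cannot outweigh the negative linear one\<close>
    define t where "t = min 1 (- S / (R + 1))"
    have t: "0 < t" "t \<le> 1" using S R by (auto simp: t_def divide_neg_pos)
    have "F ((1 - t) *\<^sub>R c + t *\<^sub>R x) - b F = a F + t * (F x - F c)" if "F \<in> I" for F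
      using affine[OF that c(1) x, of t] t by (simp add: a_def algebra_simps)
    then have "Q ((1 - t) *\<^sub>R c + t *\<^sub>R x) = (\<Sum>F\<in>I. (a F + t * (F x - F c))\<^sup>2)"
      unfolding Q_def by (intro sum.cong) simp_all
    also have "\<dots> = (\<Sum>F\<in>I. (a F)\<^sup>2 + 2 * t * (a F * (F x - F c)) + t\<^sup>2 * (F x - F c)\<^sup>2)"
      by (intro sum.cong) (simp_all add: power2_eq_square algebra_simps)
    also have "\<dots> = Q c + 2 * t * S + t\<^sup>2 * R"
      by (simp add: sum.distrib sum_distrib_left Q_def S_def R_def a_def)
    finally have eq: "Q ((1 - t) *\<^sub>R c + t *\<^sub>R x) = Q c + 2 * t * S + t\<^sup>2 * R" .
    have "(1 - t) *\<^sub>R c + t *\<^sub>R x \<in> C"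
      using C(2) c(1) x t by (intro convexD) auto
    from c(2)[OF this] eq have "0 \<le> t * (2 * S + t * R)"
      by (simp add: power2_eq_square algebra_simps)
    then have 1: "0 \<le> 2 * S + t * R" using t by (simp add: zero_le_mult_iff)
    have "t * R \<le> (- S / (R + 1)) * R" using R by (intro mult_right_mono) (auto simp: t_def)
    also have "\<dots> \<le> - S" using R S by (simp add: field_simps)
    finally show False using 1 S by linarith
  qed
  define h where "h = (\<Sum>F\<in>I. a F * F c)"
  have sumI: "(\<lambda>g. \<Sum>F\<in>I. a F * F (\<phi> g x0)) \<in> l_RUC M n G"
    using orbit cont by (intro l_RUC_sum l_RUC_scale) blast
  have "h = m (\<lambda>_. h)" by (simp add: mean_const[OF m])
  also have "\<dots> \<le> m (\<lambda>g. \<Sum>F\<in>I. a F * F (\<phi> g x0))"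
  proof (rule mean_mono[OF m l_RUC_const sumI])
    fix g assume "g \<in> carrier G"
    then have "\<phi> g x0 \<in> C" using act_in_topspace[OF basis act] x0 X(1) by blast
    from variation[OF this] show "h \<le> (\<Sum>F\<in>I. a F * F (\<phi> g x0))"
      by (simp add: h_def right_diff_distrib sum_subtractf)
  qed
  also have "\<dots> = (\<Sum>F\<in>I. m (\<lambda>g. a F * F (\<phi> g x0)))"
    using orbit cont by (intro mean_sum[OF m I] l_RUC_scale) blast
  also have "\<dots> = (\<Sum>F\<in>I. a F * b F)"
    using orbit cont unfolding b_def by (intro sum.cong mean_scale[OF m]) blast+
  finally have "h \<le> (\<Sum>F\<in>I. a F * b F)" .
  moreover have "(\<Sum>F\<in>I. (a F)\<^sup>2) = (\<Sum>F\<in>I. a F * F c - a F * b F)"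
    by (intro sum.cong) (simp_all add: a_def power2_eq_square algebra_simps)
  ultimately have "(\<Sum>F\<in>I. (a F)\<^sup>2) \<le> 0" by (simp add: h_def sum_subtractf)
  moreover have "0 \<le> (\<Sum>F\<in>I. (a F)\<^sup>2)" by (simp add: sum_nonneg)
  ultimately have "(\<Sum>F\<in>I. (a F)\<^sup>2) = 0" by simp
  then have "a F = 0" if "F \<in> I" for F
    using that I by (simp add: sum_nonneg_eq_0_iff)
  then show ?thesis using c(1) by (intro bexI[of _ c]) (auto simp: a_def b_def)
qed

text \<open>
  By compactness some \<open>c\<close> satisfies \<open>F c = m (\<lambda>g. F (\<phi> g x0))\<close> for all continuous affine \<open>F\<close> at once.
  With \<open>l\<close> also \<open>l \<circ> \<phi> g\<close> is such a function, and both have the same mean along the orbit.  So no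
  continuous linear functional \<open>l\<close> separates \<open>\<phi> g c\<close> from \<open>c\<close>.
\<close>

theorem fixed_point_of_mean:
  fixes T :: "'v::real_vector topology"
  assumes m: "is_mean M n G m" and inv: "left_invariant M n G m"
    and T: "locally_convex_space T" and C: "C \<noteq> {}" "compactin T C" "convex C"
    and basis: "is_basis (subtopology T C) \<B>"
    and act: "sigma_continuous_action M n G (subtopology T C) \<B> \<phi>" and aff: "affine_action G C \<phi>"
  shows "\<exists>c\<in>C. \<forall>g\<in>carrier G. \<phi> g c = c"
proof -
  define X where "X = subtopology T C"
  have "topspace T = UNIV" using T by (simp add: locally_convex_space_def)
  then have X: "topspace X = C" by (simp add: X_def)
  have compact: "compact_space X" using C(2) unfolding X_def by (rule compact_space_subtopology)
  note basis = basis[folded X_def] and act = act[folded X_def]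
  obtain x0 where x0: "x0 \<in> C" using C(1) by blast
  define A where "A = {F. continuous_map X euclideanreal F \<and> (\<forall>x\<in>C. \<forall>y\<in>C. \<forall>t\<in>{0..1}.
    F ((1 - t) *\<^sub>R x + t *\<^sub>R y) = (1 - t) * F x + t * F y)}"
  define b where "b F = m (\<lambda>g. F (\<phi> g x0))" for F :: "'v \<Rightarrow> real"
  define fib where "fib F = {c \<in> C. F c = b F}" for F
  have "closedin X (fib F)" if "F \<in> A" for F
    using closedin_continuous_map_preimage[of X euclideanreal F "{b F}"] that X
    by (simp add: A_def fib_def)
  moreover have "\<Inter>\<F> \<noteq> {}" if \<F>: "finite \<F>" "\<F> \<subseteq> fib ` A" for \<F>
  proof -
    obtain I where I: "I \<subseteq> A" "finite I" "\<F> = fib ` I" using \<F> by (metis finite_subset_image)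
    have "\<exists>c\<in>C. \<forall>F\<in>I. F c = m (\<lambda>g. F (\<phi> g x0))"
      using I(1) by (intro barycenter_finite[OF m C(1,3) X compact basis act x0 I(2)]) (auto simp: A_def)
    then show ?thesis unfolding I(3) fib_def b_def by blast
  qed
  ultimately have "\<Inter> (fib ` A) \<noteq> {}"
    using compact[unfolded compact_space_fip, rule_format, of "fib ` A"] by blast
  then obtain c where c: "\<And>F. F \<in> A \<Longrightarrow> c \<in> fib F" by blast
  \<comment> \<open>the family is nonempty, so that its common fibre lies in the convex set\<close>
  have "(\<lambda>_. 0) \<in> A" by (simp add: A_def)
  from c[OF this] have cC: "c \<in> C" by (simp add: fib_def)
  have "\<phi> g c = c" if g: "g \<in> carrier G" for g
  proof (rule ccontr)
    assume "\<phi> g c \<noteq> c"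
    then have "\<phi> g c - c \<noteq> 0" by simp
    from continuous_functional_nonzero[OF T this] obtain l where
      l: "linear l" "continuous_map T euclideanreal l" "l (\<phi> g c - c) \<noteq> 0" by blast
    have l_cont: "continuous_map X euclideanreal l"
      unfolding X_def using l(2) by (rule continuous_map_from_subtopology)
    have l_affine: "l ((1 - t) *\<^sub>R x + t *\<^sub>R y) = (1 - t) * l x + t * l y" for x y t
      using l(1) by (simp add: linear_add linear_scale)
    have "l \<in> A" using l_cont l_affine by (simp add: A_def)
    moreover have "(\<lambda>x. l (\<phi> g x)) \<in> A"
    proof -
      have "continuous_map X euclideanreal (\<lambda>x. l (\<phi> g x))"
        using continuous_map_compose[OF act_continuous[OF basis act g] l_cont] by (simp add: o_def)
      then show ?thesis using aff g by (simp add: A_def affine_action_def l_affine)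
    qed
    ultimately have "l c = b l" "l (\<phi> g c) = b (\<lambda>x. l (\<phi> g x))"
      using c by (auto simp: fib_def)
    moreover have "b (\<lambda>x. l (\<phi> g x)) = b l"
      unfolding b_def using mean_orbit_invariant[OF m inv basis act compact _ l_cont g] x0 X by simp
    ultimately show False using l(1,3) by (simp add: linear_diff)
  qed
  with cC show ?thesis by blast
qed

end

section \<open>The compact convex set of means\<close>

lemma product_euclidean:
  "product_topology (\<lambda>_::'a. euclideanreal) UNIV = (euclidean :: ('a \<Rightarrow> real) topology)"
  by (rule euclidean_product_topology)

text \<open>
  The topology of pointwise convergence, in which the means form a compact set.
\<close>

lemma locally_convex_product:
  "locally_convex_space (product_topology (\<lambda>_::'a. euclideanreal) UNIV)"
  (is "locally_convex_space ?T")
  unfolding locally_convex_space_def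
proof (intro conjI allI impI)
  show UNIV: "topspace ?T = UNIV" by simp
  show "Hausdorff_space ?T" by (simp add: Hausdorff_space_product_topology)
  have proj: "continuous_map ?T euclideanreal (\<lambda>x. x k)" for k
    using continuous_map_product_projection[of k UNIV "\<lambda>_. euclideanreal"] by simp
  show "continuous_map (prod_topology ?T ?T) ?T (\<lambda>(x, y). x + y)"
    unfolding continuous_map_componentwise_UNIV
  proof
    fix k
    have "continuous_map (prod_topology ?T ?T) euclideanreal (\<lambda>p. fst p k + snd p k)"
      using continuous_map_compose[OF continuous_map_fst proj] continuous_map_compose[OF continuous_map_snd proj]
      by (intro continuous_map_add) (simp_all add: o_def)
    then show "continuous_map (prod_topology ?T ?T) euclideanreal (\<lambda>p. (case p of (x, y) \<Rightarrow> x + y) k)"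
      by (simp add: case_prod_unfold)
  qed
  show "continuous_map (prod_topology euclideanreal ?T) ?T (\<lambda>(c, x). c *\<^sub>R x)"
    unfolding continuous_map_componentwise_UNIV
  proof
    fix k
    have "continuous_map (prod_topology euclideanreal ?T) euclideanreal (\<lambda>p. fst p * snd p k)"
      using continuous_map_compose[OF continuous_map_snd proj] continuous_map_fst[of euclideanreal ?T]
      by (intro continuous_map_real_mult) (simp_all add: o_def)
    then show "continuous_map (prod_topology euclideanreal ?T) euclideanreal
        (\<lambda>p. (case p of (c, x) \<Rightarrow> c *\<^sub>R x) k)"
      by (simp add: case_prod_unfold scaleR_fun_def)
  qed
  fix U assume "openin ?T U \<and> 0 \<in> U"
  then obtain V where V: "finite {i. V i \<noteq> UNIV}" "\<And>i. open (V i)" "0 \<in> PiE UNIV V" "PiE UNIV V \<subseteq> U"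
    unfolding openin_product_topology_alt by fastforce
  have "\<exists>e>0. ball 0 e \<subseteq> V i" for i
    using V(2)[of i] V(3) by (intro open_contains_ball[THEN iffD1, rule_format]) (auto simp: PiE_def Pi_def)
  then obtain e where e: "\<And>i. 0 < e i" "\<And>i. ball 0 (e i) \<subseteq> V i" by metis
  define B where "B i = (if V i = UNIV then UNIV else ball (0::real) (e i))" for i
  have "{i. B i \<noteq> UNIV} \<subseteq> {i. V i \<noteq> UNIV}" by (auto simp: B_def)
  then have "finite {i. B i \<noteq> UNIV}" using V(1) by (rule finite_subset)
  then have "openin ?T (PiE UNIV B)"
    by (intro product_topology_basis) (auto simp: B_def)
  moreover have "convex (B i)" for i by (simp add: B_def)
  then have "convex (PiE UNIV B)"
    unfolding convex_def by (simp add: PiE_UNIV_domain Pi_def scaleR_fun_def)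
  moreover have "0 \<in> PiE UNIV B" using e(1) by (simp add: PiE_UNIV_domain Pi_def B_def)
  moreover have "B i \<subseteq> V i" for i using e(2) by (simp add: B_def)
  then have "PiE UNIV B \<subseteq> PiE UNIV V" by (intro PiE_mono)
  then have "PiE UNIV B \<subseteq> U" using V(4) by (rule order_trans)
  ultimately show "\<exists>W. openin ?T W \<and> convex W \<and> 0 \<in> W \<and> W \<subseteq> U"
    by (intro exI[of _ "PiE UNIV B"] conjI)
qed

lemma sigma_topology_Int:
  "sigma_topology X \<Sigma> \<Longrightarrow> U \<in> \<Sigma> \<Longrightarrow> V \<in> \<Sigma> \<Longrightarrow> U \<inter> V \<in> \<Sigma>"
  by (simp add: sigma_topology_def)

lemma sigma_topology_Inter:
  assumes \<Sigma>: "sigma_topology X \<Sigma>" and J: "finite J" and S: "\<And>j. j \<in> J \<Longrightarrow> S j \<in> \<Sigma>"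
  shows "X \<inter> (\<Inter>j\<in>J. S j) \<in> \<Sigma>"
  using J S
proof (induction J)
  case empty
  then show ?case using \<Sigma> by (simp add: sigma_topology_def)
next
  case (insert j J)
  have "S j \<inter> (X \<inter> (\<Inter>j\<in>J. S j)) \<in> \<Sigma>"
    by (rule sigma_topology_Int[OF \<Sigma> insert.prems insert.IH[OF insert.prems]]) auto
  moreover have "S j \<inter> (X \<inter> (\<Inter>j\<in>J. S j)) = X \<inter> (\<Inter>j\<in>insert j J. S j)" by blast
  ultimately show ?case by (simp only:)
qed

lemma sigma_continuous_generated:
  assumes \<Sigma>: "sigma_topology X \<Sigma>" and f: "f \<in> X \<rightarrow> Y"
    and gen: "\<F> \<subseteq> Pow Y" "\<And>B. B \<in> \<F> \<Longrightarrow> {x \<in> X. f x \<in> B} \<in> \<Sigma>"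
  shows "sigma_continuous X \<Sigma> Y (generated_sigma_topology Y \<F>) f"
proof -
  define \<T> where "\<T> = {V. V \<subseteq> Y \<and> {x \<in> X. f x \<in> V} \<in> \<Sigma>}"
  have "sigma_topology Y \<T>"
    unfolding sigma_topology_def
  proof (intro conjI ballI allI impI)
    show "\<T> \<subseteq> Pow Y" by (auto simp: \<T>_def)
    show "{} \<in> \<T>" using \<Sigma> by (simp add: \<T>_def sigma_topology_def)
    have "{x \<in> X. f x \<in> Y} = X" using f by auto
    then show "Y \<in> \<T>" using \<Sigma> by (simp add: \<T>_def sigma_topology_def)
  next
    fix U V assume UV: "U \<in> \<T>" "V \<in> \<T>"
    have "{x \<in> X. f x \<in> U \<inter> V} = {x \<in> X. f x \<in> U} \<inter> {x \<in> X. f x \<in> V}" by auto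
    also have "\<dots> \<in> \<Sigma>" using UV \<Sigma> unfolding \<T>_def sigma_topology_def by blast
    finally show "U \<inter> V \<in> \<T>" using UV by (auto simp: \<T>_def)
  next
    fix \<U> assume \<U>: "countable \<U> \<and> \<U> \<subseteq> \<T>"
    have "{x \<in> X. f x \<in> \<Union>\<U>} = \<Union> ((\<lambda>V. {x \<in> X. f x \<in> V}) ` \<U>)" by auto
    also have "\<dots> \<in> \<Sigma>"
      using \<U> by (intro sigma_topology_Union[OF \<Sigma>]) (auto simp: \<T>_def)
    finally show "\<Union>\<U> \<in> \<T>" using \<U> by (auto simp: \<T>_def)
  qed
  moreover have "\<F> \<subseteq> \<T>" using gen by (auto simp: \<T>_def)
  ultimately have "generated_sigma_topology Y \<F> \<subseteq> \<T>"
    by (rule generated_sigma_topology_least)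
  with f show ?thesis by (auto simp: sigma_continuous_def \<T>_def)
qed

context definable_group_on
begin

lemma l_RUC_below: "f \<in> l_RUC M n G \<Longrightarrow> bdd_below (f ` carrier G)"
  and l_RUC_above: "f \<in> l_RUC M n G \<Longrightarrow> bdd_above (f ` carrier G)"
  using l_RUC_bounded by (auto intro: bounded_imp_bdd_below bounded_imp_bdd_above)

lemma is_meanI:
  assumes "\<And>f f'. f \<in> l_RUC M n G \<Longrightarrow> f' \<in> l_RUC M n G \<Longrightarrow> m (\<lambda>x. f x + f' x) = m f + m f'"
    and "\<And>f c. f \<in> l_RUC M n G \<Longrightarrow> m (\<lambda>x. c * f x) = c * m f"
    and "\<And>f c. f \<in> l_RUC M n G \<Longrightarrow> (\<And>x. x \<in> carrier G \<Longrightarrow> c \<le> f x) \<Longrightarrow> c \<le> m f"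
    and "\<And>f c. f \<in> l_RUC M n G \<Longrightarrow> (\<And>x. x \<in> carrier G \<Longrightarrow> f x \<le> c) \<Longrightarrow> m f \<le> c"
  shows "is_mean M n G m"
  unfolding is_mean_def
  using assms(1,2) by (auto intro!: assms(3,4) intro: cINF_lower l_RUC_below cSUP_upper l_RUC_above)

lemma mean_ge:
  assumes "is_mean M n G m" "f \<in> l_RUC M n G" "\<And>x. x \<in> carrier G \<Longrightarrow> c \<le> f x"
  shows "c \<le> m f"
  using mean_mono[OF assms(1) l_RUC_const assms(2), of c] assms(3) mean_const[OF assms(1), of c] by simp

lemma mean_le:
  assumes "is_mean M n G m" "f \<in> l_RUC M n G" "\<And>x. x \<in> carrier G \<Longrightarrow> f x \<le> c"
  shows "m f \<le> c"
  using mean_mono[OF assms(1,2) l_RUC_const, of c] assms(3) mean_const[OF assms(1), of c] by simp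

lemma mean_close:
  assumes m: "is_mean M n G m" and f: "f \<in> l_RUC M n G" and f': "f' \<in> l_RUC M n G"
    and le: "\<And>x. x \<in> carrier G \<Longrightarrow> \<bar>f x - f' x\<bar> \<le> e"
  shows "\<bar>m f - m f'\<bar> \<le> e"
proof -
  have "m f \<le> m (\<lambda>x. f' x + e)" "m f' \<le> m (\<lambda>x. f x + e)"
    using le by (intro mean_mono[OF m] f f' l_RUC_add l_RUC_const; fastforce simp: abs_le_iff)+
  then show ?thesis
    using mean_add[OF m f l_RUC_const, of e] mean_add[OF m f' l_RUC_const, of e] mean_const[OF m, of e]
    by (simp add: abs_le_iff)
qed

text \<open>
  The value of a mean off \<open>l_RUC\<close> is arbitrary.  Fixing it as \<open>0\<close> makes the set of means compact in the
  product topology.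
\<close>

definition means :: "(('m list \<Rightarrow> real) \<Rightarrow> real) set" where
  "means = {m. is_mean M n G m \<and> (\<forall>f. f \<notin> l_RUC M n G \<longrightarrow> m f = 0)}"

abbreviation mean_topology :: "(('m list \<Rightarrow> real) \<Rightarrow> real) topology" where
  "mean_topology \<equiv> product_topology (\<lambda>_. euclideanreal) UNIV"

lemma meansD: "m \<in> means \<Longrightarrow> is_mean M n G m" "m \<in> means \<Longrightarrow> f \<notin> l_RUC M n G \<Longrightarrow> m f = 0"
  by (auto simp: means_def)

lemma means_nonempty: "means \<noteq> {}"
proof -
  define m where "m f = (if f \<in> l_RUC M n G then f \<one> else 0)" for f :: "'m list \<Rightarrow> real"
  have "is_mean M n G m"
    by (rule is_meanI) (auto simp: m_def l_RUC_add l_RUC_scale)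
  then have "m \<in> means" by (simp add: means_def m_def)
  then show ?thesis by blast
qed

lemma means_convex: "convex means"
  unfolding convex_def
proof (intro ballI allI impI)
  fix m m' and u v :: real
  assume m: "m \<in> means" "m' \<in> means" and uv: "0 \<le> u" "0 \<le> v" "u + v = 1"
  have "is_mean M n G (u *\<^sub>R m + v *\<^sub>R m')"
  proof (rule is_meanI)
    fix f and c :: real assume f: "f \<in> l_RUC M n G" "\<And>x. x \<in> carrier G \<Longrightarrow> c \<le> f x"
    have "c = u * c + v * c" using uv by (simp add: distrib_right[symmetric])
    also have "\<dots> \<le> u * m f + v * m' f"
      using uv f mean_ge[OF meansD(1)[OF m(1)]] mean_ge[OF meansD(1)[OF m(2)]]
      by (intro add_mono mult_left_mono) blast+
    finally show "c \<le> (u *\<^sub>R m + v *\<^sub>R m') f" by (simp add: scaleR_fun_def)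
  next
    fix f and c :: real assume f: "f \<in> l_RUC M n G" "\<And>x. x \<in> carrier G \<Longrightarrow> f x \<le> c"
    have "u * m f + v * m' f \<le> u * c + v * c"
      using uv f mean_le[OF meansD(1)[OF m(1)]] mean_le[OF meansD(1)[OF m(2)]]
      by (intro add_mono mult_left_mono) blast+
    also have "\<dots> = c" using uv by (simp add: distrib_right[symmetric])
    finally show "(u *\<^sub>R m + v *\<^sub>R m') f \<le> c" by (simp add: scaleR_fun_def)
  qed (simp_all add: scaleR_fun_def mean_add[OF meansD(1)] mean_scale[OF meansD(1)] m algebra_simps)
  with m show "u *\<^sub>R m + v *\<^sub>R m' \<in> means" by (simp add: means_def scaleR_fun_def)
qed

lemma means_compact: "compactin mean_topology means"
proof -
  have "\<exists>b. \<forall>m\<in>means. m f \<in> {- b .. b}" for f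
  proof (cases "f \<in> l_RUC M n G")
    case True
    then obtain b where b: "\<And>x. x \<in> carrier G \<Longrightarrow> \<bar>f x\<bar> \<le> b"
      using l_RUC_bounded[OF True] by (auto simp: bounded_iff)
    have "m f \<in> {- b .. b}" if "m \<in> means" for m
      using mean_ge[OF meansD(1)[OF that] True, of "- b"] mean_le[OF meansD(1)[OF that] True, of b] b
      by (force simp: abs_le_iff)
    then show ?thesis by blast
  next
    case False
    then show ?thesis using meansD(2) by (intro exI[of _ 0]) auto
  qed
  then obtain b where b: "\<And>f m. m \<in> means \<Longrightarrow> m f \<in> {- b f .. b f}" by metis
  have box: "compactin mean_topology (PiE UNIV (\<lambda>f. {- b f .. b f}))"
    by (simp add: compactin_PiE)
  have in_box: "means \<subseteq> PiE UNIV (\<lambda>f. {- b f .. b f})" using b by blast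
  have coord: "continuous_on UNIV (\<lambda>m :: ('m list \<Rightarrow> real) \<Rightarrow> real. m f)" for f
    by (rule continuous_on_product_coordinates)
  let ?R = "l_RUC M n G"
  have "means = (\<Inter>f\<in>?R. \<Inter>f'\<in>?R. {m. m (\<lambda>x. f x + f' x) = m f + m f'}) \<inter>
      (\<Inter>f\<in>?R. \<Inter>c. {m. m (\<lambda>x. c * f x) = c * m f}) \<inter>
      (\<Inter>f\<in>?R. {m. (INF x\<in>carrier G. f x) \<le> m f}) \<inter> (\<Inter>f\<in>?R. {m. m f \<le> (SUP x\<in>carrier G. f x)}) \<inter>
      (\<Inter>f\<in>{f. f \<notin> ?R}. {m. m f = 0})"
    by (rule Set.set_eqI) (simp add: means_def is_mean_def ball_conj_distrib)
  also have "closed \<dots>"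
    by (intro closed_Int closed_INT ballI closed_Collect_eq closed_Collect_le continuous_on_add
        continuous_on_mult continuous_on_const coord)
  finally have "closedin mean_topology means"
    unfolding product_euclidean by simp
  with box in_box show ?thesis by (rule closed_compactin)
qed

text \<open>
  Restricted to \<open>means\<close>, as the bijections that form the group \<open>BijGroup means\<close> are extensional.
\<close>

definition mean_action :: "'m list \<Rightarrow> (('m list \<Rightarrow> real) \<Rightarrow> real) \<Rightarrow> ('m list \<Rightarrow> real) \<Rightarrow> real" where
  "mean_action a = (\<lambda>m\<in>means. \<lambda>f. if f \<in> l_RUC M n G then m (\<lambda>x. f (a \<otimes> x)) else 0)"

lemma mean_action_apply:
  "m \<in> means \<Longrightarrow> f \<in> l_RUC M n G \<Longrightarrow> mean_action a m f = m (\<lambda>x. f (a \<otimes> x))"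
  by (simp add: mean_action_def)

lemma mean_action_outside: "m \<in> means \<Longrightarrow> f \<notin> l_RUC M n G \<Longrightarrow> mean_action a m f = 0"
  by (simp add: mean_action_def)

lemma mean_action_in_means:
  assumes a: "a \<in> carrier G" and m: "m \<in> means"
  shows "mean_action a m \<in> means"
proof -
  note mm = meansD(1)[OF m]
  have "is_mean M n G (mean_action a m)"
  proof (rule is_meanI)
    fix f and c :: real assume f: "f \<in> l_RUC M n G"
    note fa = l_RUC_translate[OF f a]
    show "c \<le> mean_action a m f" if "\<And>x. x \<in> carrier G \<Longrightarrow> c \<le> f x"
      unfolding mean_action_apply[OF m f] using a that by (intro mean_ge[OF mm fa]) simp
    show "mean_action a m f \<le> c" if "\<And>x. x \<in> carrier G \<Longrightarrow> f x \<le> c"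
      unfolding mean_action_apply[OF m f] using a that by (intro mean_le[OF mm fa]) simp
  qed (simp_all add: mean_action_apply m l_RUC_add l_RUC_scale mean_add[OF mm] mean_scale[OF mm]
      l_RUC_translate a)
  then show ?thesis by (simp add: means_def mean_action_outside[OF m])
qed

lemma mean_action_mult:
  assumes a: "a \<in> carrier G" and b: "b \<in> carrier G" and m: "m \<in> means"
  shows "mean_action (a \<otimes> b) m = mean_action a (mean_action b m)"
proof
  fix f
  show "mean_action (a \<otimes> b) m f = mean_action a (mean_action b m) f"
  proof (cases "f \<in> l_RUC M n G")
    case True
    have fa: "(\<lambda>x. f (a \<otimes> x)) \<in> l_RUC M n G" using True a by (rule l_RUC_translate)
    have "m (\<lambda>x. f ((a \<otimes> b) \<otimes> x)) = m (\<lambda>x. f (a \<otimes> (b \<otimes> x)))"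
      using a b by (intro mean_cong[OF meansD(1)[OF m]] l_RUC_translate[OF True]) (simp_all add: m_assoc)
    then show ?thesis
      by (simp add: mean_action_apply m mean_action_in_means b True fa)
  qed (simp add: mean_action_outside mean_action_in_means m b)
qed

lemma mean_action_one: "m \<in> means \<Longrightarrow> mean_action \<one> m = m"
proof
  fix f assume m: "m \<in> means"
  show "mean_action \<one> m f = m f"
  proof (cases "f \<in> l_RUC M n G")
    case True
    have "m f = m (\<lambda>x. f (\<one> \<otimes> x))"
      by (rule mean_cong[OF meansD(1)[OF m] True]) simp
    then show ?thesis by (simp add: mean_action_apply m True)
  qed (simp add: mean_action_outside m meansD)
qed

lemma mean_action_group_action: "group_action G means mean_action"
proof -
  have bij: "mean_action a \<in> Bij means" if a: "a \<in> carrier G" for a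
  proof -
    have "bij_betw (mean_action a) means means"
      using a mean_action_mult[of "inv a" a] mean_action_mult[of a "inv a"]
      by (intro bij_betw_byWitness[where f' = "mean_action (inv a)"])
        (auto simp: mean_action_in_means mean_action_one)
    then show ?thesis by (simp add: Bij_def mean_action_def)
  qed
  have "mean_action (a \<otimes> b) = compose means (mean_action a) (mean_action b)"
    if "a \<in> carrier G" "b \<in> carrier G" for a b
    using mean_action_mult[OF that] by (auto simp: compose_def mean_action_def fun_eq_iff)
  with bij have "mean_action \<in> hom G (BijGroup means)"
    by (auto simp: hom_def BijGroup_def)
  then show ?thesis
    by (auto simp: group_action_def group_hom_def group_hom_axioms_def group_BijGroup is_group)
qed

lemma mean_action_affine: "affine_action G means mean_action"
  unfolding affine_action_def
proof (intro ballI)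
  fix a m m' and t :: real assume a: "a \<in> carrier G" and m: "m \<in> means" "m' \<in> means" and t: "t \<in> {0..1}"
  have "(1 - t) *\<^sub>R m + t *\<^sub>R m' \<in> means"
    using means_convex m t by (intro convexD) auto
  then show "mean_action a ((1 - t) *\<^sub>R m + t *\<^sub>R m') = (1 - t) *\<^sub>R mean_action a m + t *\<^sub>R mean_action a m'"
    using m by (auto simp: mean_action_def fun_eq_iff scaleR_fun_def)
qed

definition halfspace :: "('m list \<Rightarrow> real) \<times> real \<Rightarrow> (('m list \<Rightarrow> real) \<Rightarrow> real) set" where
  "halfspace = (\<lambda>(f, q). {m. m f < q})"

text \<open>
  Half-spaces suffice to make the evaluations \<open>m \<mapsto> m f\<close> measurable for the generated sigma-algebra, and
  they are simple enough for the action to be sigma-continuous.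
\<close>

definition mean_basis :: "(('m list \<Rightarrow> real) \<Rightarrow> real) set set" where
  "mean_basis = {means \<inter> (\<Inter>j\<in>J. halfspace j) | J. finite J}"

lemma halfspace_in_basis: "means \<inter> halfspace j \<in> mean_basis"
  unfolding mean_basis_def by (intro CollectI exI[of _ "{j}"]) simp

lemma means_minus:
  assumes m: "m \<in> means"
  shows "m (\<lambda>x. - 1 * f x) = - m f"
proof (cases "f \<in> l_RUC M n G")
  case True
  then show ?thesis using mean_scale[OF meansD(1)[OF m] True, of "-1"] by simp
next
  case False
  have "(\<lambda>x. - 1 * f x) \<notin> l_RUC M n G"
    using l_RUC_scale[of "\<lambda>x. - 1 * f x" "-1"] False by auto
  with False show ?thesis using meansD(2)[OF m] by simp
qed

text \<open>
  An open interval of values at \<open>f\<close> is the intersection of a half-space at \<open>f\<close> and one at \<open>- f\<close>, since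
  \<open>m (- f) = - m f\<close>; this also holds for \<open>f\<close> outside \<open>l_RUC\<close>, where both sides are \<open>0\<close>.
\<close>

lemma mean_basis_is_basis: "is_basis (subtopology mean_topology means) mean_basis"
  unfolding is_basis_iff
proof (intro conjI ballI allI impI)
  fix B assume "B \<in> mean_basis"
  then obtain J where J: "finite J" "B = means \<inter> (\<Inter>j\<in>J. halfspace j)"
    by (auto simp: mean_basis_def)
  have "open (halfspace j)" for j
    unfolding halfspace_def case_prod_unfold
    by (intro open_Collect_less continuous_on_const continuous_on_product_coordinates)
  then have "open (\<Inter>j\<in>J. halfspace j)" using J(1) by (intro open_INT) auto
  then show "openin (subtopology mean_topology means) B"
    unfolding J(2) product_euclidean by (simp add: openin_open_Int)
next
  fix U x assume "openin (subtopology mean_topology means) U \<and> x \<in> U"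
  then obtain V where V: "openin mean_topology V" "U = V \<inter> means" "x \<in> V" and x: "x \<in> means"
    by (auto simp: openin_subtopology)
  then obtain W where W: "finite {f. W f \<noteq> UNIV}" "\<And>f. open (W f)" "x \<in> PiE UNIV W" "PiE UNIV W \<subseteq> V"
    unfolding openin_product_topology_alt by fastforce
  have "\<exists>e>0. ball (x f) e \<subseteq> W f" for f
    using W(2)[of f] W(3) by (intro open_contains_ball[THEN iffD1, rule_format]) (auto simp: PiE_def Pi_def)
  then obtain e where e: "\<And>f. 0 < e f" "\<And>f. ball (x f) (e f) \<subseteq> W f" by metis
  define S where "S = {f. W f \<noteq> UNIV}"
  define J where "J = (\<lambda>f. (f, x f + e f)) ` S \<union> (\<lambda>f. (\<lambda>y. - 1 * f y, - x f + e f)) ` S"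
  define B where "B = means \<inter> (\<Inter>j\<in>J. halfspace j)"
  have "finite J" using W(1) by (simp add: J_def S_def)
  then have "B \<in> mean_basis" unfolding B_def mean_basis_def by blast
  moreover have "x \<in> B"
    using x e(1) means_minus[OF x] by (auto simp: B_def J_def halfspace_def)
  moreover have "B \<subseteq> U"
  proof
    fix m assume m: "m \<in> B"
    then have mm: "m \<in> means" by (simp add: B_def)
    have "m f \<in> W f" for f
    proof (cases "f \<in> S")
      case True
      then have "m f < x f + e f" "m (\<lambda>y. - 1 * f y) < - x f + e f"
        using m by (auto simp: B_def J_def halfspace_def)
      then have "m f \<in> ball (x f) (e f)"
        unfolding means_minus[OF mm] by (auto simp: dist_real_def abs_less_iff)
      with e(2) show ?thesis by blast
    qed (simp add: S_def)
    then show "m \<in> U" using W(4) V(2) mm by (auto simp: PiE_UNIV_domain)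
  qed
  ultimately show "\<exists>B\<in>mean_basis. x \<in> B \<and> B \<subseteq> U" by blast
qed

text \<open>
  This is where logical right uniform continuity enters.  On each of countably many definable pieces, the
  translates of \<open>f\<close> by the elements of the piece lie within \<open>1 / (k + 1)\<close> of the translate by one
  representative \<open>r k j\<close>, and the same holds for their means.  Hence \<open>m (\<lambda>x. f (g \<otimes> x)) < q\<close> if and
  only if, for some \<open>k\<close> and some piece that contains \<open>g\<close>, the mean of the translate by the representative
  is less than \<open>q - 1 / (k + 1)\<close>.
\<close>

lemma mean_action_halfspace:
  assumes f: "f \<in> l_RUC M n G"
  obtains \<Theta> r where "\<And>k j::nat. definable M n (\<Theta> k j)" "\<And>k j. \<Theta> k j \<subseteq> carrier G"
    "{z \<in> carrier G \<times> means. mean_action (fst z) (snd z) f < q} =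
      (\<Union>k. \<Union>j. \<Theta> k j \<times> (means \<inter> halfspace (\<lambda>x. f (r k j \<otimes> x), q - 1 / Suc k)))"
proof -
  define good where "good k \<Theta> \<longleftrightarrow> (\<forall>j::nat. definable M n (\<Theta> j) \<and> \<Theta> j \<subseteq> carrier G) \<and>
    (\<forall>g\<in>carrier G. \<exists>j. g \<in> \<Theta> j) \<and>
    (\<forall>j. \<forall>g\<in>\<Theta> j. \<forall>g'\<in>\<Theta> j. \<forall>h\<in>carrier G. \<bar>f (g \<otimes> h) - f (g' \<otimes> h)\<bar> < 1 / Suc k)" for k \<Theta>
  have "\<forall>k. \<exists>\<Theta>. good k \<Theta>"
  proof
    fix k :: nat
    have "0 < 1 / real (Suc k)" by simp
    from l_RUC_E[OF f this] show "\<exists>\<Theta>. good k \<Theta>" unfolding good_def by metis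
  qed
  then obtain \<Theta> where good: "\<And>k. good k (\<Theta> k)" unfolding choice_iff by blast
  have \<Theta>: "definable M n (\<Theta> k j)" "\<Theta> k j \<subseteq> carrier G" for k j
    using good[of k] by (simp_all add: good_def)
  have cover: "\<exists>j. g \<in> \<Theta> k j" if "g \<in> carrier G" for g k
    using good[of k] that by (simp add: good_def)
  \<comment> \<open>arbitrary for an empty piece, whose rectangle is empty as well\<close>
  define r where "r k j = (SOME g. g \<in> \<Theta> k j)" for k j
  have r: "r k j \<in> \<Theta> k j" if "g \<in> \<Theta> k j" for g k j
    unfolding r_def using that by (rule someI)
  have close: "\<bar>m (\<lambda>x. f (g \<otimes> x)) - m (\<lambda>x. f (r k j \<otimes> x))\<bar> \<le> 1 / Suc k"
    if g: "g \<in> \<Theta> k j" and m: "m \<in> means" for g k j m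
  proof (rule mean_close[OF meansD(1)[OF m]])
    show "(\<lambda>x. f (g \<otimes> x)) \<in> l_RUC M n G" "(\<lambda>x. f (r k j \<otimes> x)) \<in> l_RUC M n G"
      using g r[OF g] \<Theta>(2) by (blast intro: l_RUC_translate[OF f])+
    show "\<bar>f (g \<otimes> x) - f (r k j \<otimes> x)\<bar> \<le> 1 / Suc k" if "x \<in> carrier G" for x
      using good[of k] g r[OF g] that by (auto simp: good_def intro: less_imp_le)
  qed
  have "{z \<in> carrier G \<times> means. mean_action (fst z) (snd z) f < q} =
      (\<Union>k. \<Union>j. \<Theta> k j \<times> (means \<inter> halfspace (\<lambda>x. f (r k j \<otimes> x), q - 1 / Suc k)))" (is "?L = ?R")
  proof (intro equalityI subsetI)
    fix z assume "z \<in> ?L"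
    then obtain g m where z: "z = (g, m)" "g \<in> carrier G" "m \<in> means" "m (\<lambda>x. f (g \<otimes> x)) < q"
      by (auto simp: mean_action_apply f)
    then obtain k where k: "1 / real (Suc k) < (q - m (\<lambda>x. f (g \<otimes> x))) / 2"
      using nat_approx_posE[of "(q - m (\<lambda>x. f (g \<otimes> x))) / 2"] by auto
    obtain j where j: "g \<in> \<Theta> k j" using cover[OF z(2)] by blast
    have "m (\<lambda>x. f (r k j \<otimes> x)) < q - 1 / Suc k"
      using close[OF j z(3)] k by (simp add: abs_le_iff)
    with j z show "z \<in> ?R" by (auto simp: halfspace_def)
  next
    fix z assume "z \<in> ?R"
    then obtain g m k j where z: "z = (g, m)" "g \<in> \<Theta> k j" "m \<in> means"
        "m (\<lambda>x. f (r k j \<otimes> x)) < q - 1 / Suc k"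
      by (auto simp: halfspace_def)
    have "m (\<lambda>x. f (g \<otimes> x)) < q"
      using close[OF z(2,3)] z(4) by (simp add: abs_le_iff)
    with z \<Theta>(2) show "z \<in> ?L" by (auto simp: mean_action_apply f)
  qed
  with \<Theta> show thesis by (rule that)
qed

lemma mean_action_sigma_continuous:
  "sigma_continuous_action M n G (subtopology mean_topology means) mean_basis mean_action"
proof -
  have top: "topspace (subtopology mean_topology means) = means" by simp
  define gens where "gens = {D \<times> B | D B. definable M n D \<and> D \<subseteq> carrier G \<and> B \<in> mean_basis}"
  define \<Sigma> where "\<Sigma> = generated_sigma_topology (carrier G \<times> means) gens"
  have sub: "mean_basis \<subseteq> Pow means" by (auto simp: mean_basis_def)
  then have "gens \<subseteq> Pow (carrier G \<times> means)" by (auto simp: gens_def)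
  then have \<Sigma>: "sigma_topology (carrier G \<times> means) \<Sigma>"
    unfolding \<Sigma>_def by (rule sigma_topology_generated)
  have gens: "gens \<subseteq> \<Sigma>" unfolding \<Sigma>_def by (rule generated_sigma_topology_base)
  have half: "{z \<in> carrier G \<times> means. mean_action (fst z) (snd z) f < q} \<in> \<Sigma>" for f q
  proof (cases "f \<in> l_RUC M n G")
    case False
    then have "{z \<in> carrier G \<times> means. mean_action (fst z) (snd z) f < q} =
        (if 0 < q then carrier G \<times> means else {})"
      by (auto simp: mean_action_outside)
    with \<Sigma> show ?thesis by (simp add: sigma_topology_def)
  next
    case True
    obtain \<Theta> r where \<Theta>: "\<And>k j::nat. definable M n (\<Theta> k j)" "\<And>k j. \<Theta> k j \<subseteq> carrier G"
      and eq: "{z \<in> carrier G \<times> means. mean_action (fst z) (snd z) f < q} =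
        (\<Union>k. \<Union>j. \<Theta> k j \<times> (means \<inter> halfspace (\<lambda>x. f (r k j \<otimes> x), q - 1 / Suc k)))"
      by (rule mean_action_halfspace[OF True, of q], rule that)
    have "\<Theta> k j \<times> (means \<inter> halfspace p) \<in> gens" for k j p
      unfolding gens_def using \<Theta>[of k j] halfspace_in_basis[of p]
      by (intro CollectI exI[of _ "\<Theta> k j"] exI[of _ "means \<inter> halfspace p"] conjI) simp_all
    then have "\<Theta> k j \<times> (means \<inter> halfspace p) \<in> \<Sigma>" for k j p
      using gens by (rule subsetD[rotated])
    then show ?thesis
      unfolding eq by (intro sigma_topology_Union[OF \<Sigma>]) (auto intro: sigma_topology_Union[OF \<Sigma>])
  qed
  have "sigma_continuous (carrier G \<times> means) \<Sigma> means (generated_sigma_topology means mean_basis)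
      (\<lambda>z. mean_action (fst z) (snd z))"
  proof (rule sigma_continuous_generated[OF \<Sigma> _ sub])
    show "(\<lambda>z. mean_action (fst z) (snd z)) \<in> carrier G \<times> means \<rightarrow> means"
      by (auto simp: mean_action_in_means)
    fix B assume "B \<in> mean_basis"
    then obtain J where J: "finite J" "B = means \<inter> (\<Inter>j\<in>J. halfspace j)"
      by (auto simp: mean_basis_def)
    have "{z \<in> carrier G \<times> means. mean_action (fst z) (snd z) \<in> B} = (carrier G \<times> means) \<inter>
        (\<Inter>j\<in>J. {z \<in> carrier G \<times> means. mean_action (fst z) (snd z) (fst j) < snd j})"
      by (auto simp: J(2) halfspace_def mean_action_in_means case_prod_unfold)
    also have "\<dots> \<in> \<Sigma>"
      by (rule sigma_topology_Inter[OF \<Sigma> J(1) half])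
    finally show "{z \<in> carrier G \<times> means. mean_action (fst z) (snd z) \<in> B} \<in> \<Sigma>" .
  qed
  then show ?thesis
    unfolding sigma_continuous_action_def top
    using mean_action_group_action by (simp add: \<Sigma>_def gens_def case_prod_unfold)
qed

lemma fixed_mean_left_invariant:
  assumes m: "m \<in> means" and fixed: "\<And>a. a \<in> carrier G \<Longrightarrow> mean_action a m = m"
  shows "left_invariant M n G m"
  unfolding left_invariant_def
proof (intro ballI)
  fix a f assume "a \<in> carrier G" "f \<in> l_RUC M n G"
  then show "m (\<lambda>x. f (a \<otimes> x)) = m f"
    using mean_action_apply[OF m, of f a] fixed[of a] by simp
qed

theorem mean_of_fixed_point_property:
  assumes "fixed_point_property M n G TYPE('m mean_space)"
  shows "has_left_invariant_mean M n G"
proof -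
  have "\<exists>m\<in>means. \<forall>a\<in>carrier G. mean_action a m = m"
    using assms locally_convex_product means_nonempty means_compact means_convex mean_basis_is_basis
      mean_action_sigma_continuous mean_action_affine
    unfolding fixed_point_property_def by blast
  then show ?thesis
    using fixed_mean_left_invariant meansD(1) unfolding has_left_invariant_mean_def by blast
qed

text \<open>
  An invariant measure on the set of means is averaged to the single mean \<open>f \<mapsto> \<integral> m f d\<mu>\<close>; it is
  left-invariant because the measure is.
\<close>

theorem mean_of_invariant_measure_property:
  assumes "invariant_measure_property M n G TYPE('m mean_space)"
  shows "has_left_invariant_mean M n G"
proof -
  have top: "topspace (subtopology mean_topology means) = means" by simp
  have "compact_space (subtopology mean_topology means)"
    using means_compact by (rule compact_space_subtopology)
  moreover have "Hausdorff_space (subtopology mean_topology means)"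
    by (intro Hausdorff_space_subtopology) (simp add: Hausdorff_space_product_topology)
  ultimately obtain \<mu> where \<mu>: "space \<mu> = means" "sets \<mu> = sigma_sets means mean_basis" "prob_space \<mu>"
    and inv: "\<And>g A. g \<in> carrier G \<Longrightarrow> A \<in> sets \<mu> \<Longrightarrow>
      emeasure \<mu> {x \<in> means. mean_action g x \<in> A} = emeasure \<mu> A"
    using assms[unfolded invariant_measure_property_def, rule_format,
        of "subtopology mean_topology means" mean_basis mean_action]
      mean_basis_is_basis mean_action_sigma_continuous means_nonempty
    unfolding top by blast
  interpret prob_space \<mu> by (rule \<mu>(3))
  have meas: "(\<lambda>m. m f) \<in> borel_measurable \<mu>" for f
    unfolding borel_measurable_iff_less
  proof
    fix q
    have "{m \<in> space \<mu>. m f < q} = means \<inter> halfspace (f, q)"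
      by (auto simp: \<mu>(1) halfspace_def)
    then show "{m \<in> space \<mu>. m f < q} \<in> sets \<mu>"
      using halfspace_in_basis by (simp add: \<mu>(2) sigma_sets.Basic)
  qed
  have integrable: "integrable \<mu> (\<lambda>m. m f)" if f: "f \<in> l_RUC M n G" for f
  proof -
    obtain b where b: "\<And>x. x \<in> carrier G \<Longrightarrow> \<bar>f x\<bar> \<le> b"
      using l_RUC_bounded[OF f] by (auto simp: bounded_iff)
    have "norm (m f) \<le> b" if "m \<in> means" for m
      using mean_ge[OF meansD(1)[OF that] f, of "- b"] mean_le[OF meansD(1)[OF that] f, of b] b
      by (force simp: abs_le_iff)
    then show ?thesis
      by (intro integrable_const_bound[of _ b] meas AE_I2) (simp add: \<mu>(1))
  qed
  define \<nu> where "\<nu> f = (\<integral>m. m f \<partial>\<mu>)" for f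
  have "is_mean M n G \<nu>"
  proof (rule is_meanI)
    fix f f' assume ff': "f \<in> l_RUC M n G" "f' \<in> l_RUC M n G"
    have "\<nu> (\<lambda>x. f x + f' x) = (\<integral>m. m f + m f' \<partial>\<mu>)"
      unfolding \<nu>_def by (rule Bochner_Integration.integral_cong) (simp_all add: \<mu>(1) mean_add meansD ff')
    then show "\<nu> (\<lambda>x. f x + f' x) = \<nu> f + \<nu> f'"
      using integrable ff' by (simp add: \<nu>_def)
  next
    fix f and c :: real assume f: "f \<in> l_RUC M n G"
    have "\<nu> (\<lambda>x. c * f x) = (\<integral>m. c * m f \<partial>\<mu>)"
      unfolding \<nu>_def by (rule Bochner_Integration.integral_cong) (simp_all add: \<mu>(1) mean_scale meansD f)
    then show "\<nu> (\<lambda>x. c * f x) = c * \<nu> f" by (simp add: \<nu>_def)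
    show "c \<le> \<nu> f" if "\<And>x. x \<in> carrier G \<Longrightarrow> c \<le> f x"
      unfolding \<nu>_def using mean_ge[OF meansD(1) f that] \<mu>(1)
      by (intro integral_ge_const integrable[OF f] AE_I2) simp
    show "\<nu> f \<le> c" if "\<And>x. x \<in> carrier G \<Longrightarrow> f x \<le> c"
      unfolding \<nu>_def using mean_le[OF meansD(1) f that] \<mu>(1)
      by (intro integral_le_const integrable[OF f] AE_I2) simp
  qed
  moreover have "left_invariant M n G \<nu>"
    unfolding left_invariant_def
  proof (intro ballI)
    fix a f assume a: "a \<in> carrier G" and f: "f \<in> l_RUC M n G"
    have preimage: "mean_action a -` A \<inter> space \<mu> = {m \<in> means. mean_action a m \<in> A}" for A
      by (auto simp: \<mu>(1))
    have act: "mean_action a \<in> measurable \<mu> \<mu>"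
    proof (rule measurableI)
      show "mean_action a m \<in> space \<mu>" if "m \<in> space \<mu>" for m
        using that a by (simp add: \<mu>(1) mean_action_in_means)
      fix A assume "A \<in> sets \<mu>"
      then show "mean_action a -` A \<inter> space \<mu> \<in> sets \<mu>"
        unfolding preimage \<mu>(2)
        using act_preimage_sigma_sets[OF mean_basis_is_basis mean_action_sigma_continuous a]
        unfolding top by blast
    qed
    have distr: "distr \<mu> \<mu> (mean_action a) = \<mu>"
      by (rule measure_eqI) (simp_all add: emeasure_distr[OF act] preimage inv[OF a])
    have "\<nu> (\<lambda>x. f (a \<otimes> x)) = (\<integral>m. mean_action a m f \<partial>\<mu>)"
      unfolding \<nu>_def by (rule Bochner_Integration.integral_cong) (simp_all add: \<mu>(1) mean_action_apply f)
    also have "\<dots> = (\<integral>m. m f \<partial>distr \<mu> \<mu> (mean_action a))"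
      using integral_distr[OF act meas] by simp
    also have "\<dots> = \<nu> f" unfolding distr \<nu>_def ..
    finally show "\<nu> (\<lambda>x. f (a \<otimes> x)) = \<nu> f" .
  qed
  ultimately show ?thesis unfolding has_left_invariant_mean_def by blast
qed

end

section \<open>Equivalence of the three properties\<close>

theorem theorem3p7:
  fixes M :: "('f, 'r, 'm) fo_structure" and n :: nat and G :: "'m list monoid"
  assumes "definable_group M n G"
  shows "(fixed_point_property M n G TYPE('m mean_space) \<longleftrightarrow> has_left_invariant_mean M n G) \<and>
         (has_left_invariant_mean M n G \<longleftrightarrow> invariant_measure_property M n G TYPE('m mean_space)) \<and>
         (has_left_invariant_mean M n G \<longrightarrow>
            fixed_point_property M n G TYPE('v::real_vector) \<and>
            invariant_measure_property M n G TYPE('x))"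
proof -
  interpret definable_group_on M n G
    using assms by (rule definable_group_on.intro)
  have fixed: "fixed_point_property M n G TYPE('w::real_vector)"
    if mean: "has_left_invariant_mean M n G"
    unfolding fixed_point_property_def
  proof (intro allI impI, elim conjE)
    fix T :: "'w topology" and C \<B> \<phi>
    assume "locally_convex_space T" "C \<noteq> {}" "compactin T C" "convex C"
      "is_basis (subtopology T C) \<B>"
      "sigma_continuous_action M n G (subtopology T C) \<B> \<phi>" "affine_action G C \<phi>"
    moreover obtain m where "is_mean M n G m" "left_invariant M n G m"
      using mean by (auto simp: has_left_invariant_mean_def)
    ultimately show "\<exists>c\<in>C. \<forall>g\<in>carrier G. \<phi> g c = c"
      by (intro fixed_point_of_mean)
  qed
  have measure: "invariant_measure_property M n G TYPE('y)"
    if mean: "has_left_invariant_mean M n G"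
    unfolding invariant_measure_property_def
  proof (intro allI impI, elim conjE)
    fix X :: "'y topology" and \<B> \<phi>
    assume X: "topspace X \<noteq> {}" "compact_space X" "Hausdorff_space X" "is_basis X \<B>"
      "sigma_continuous_action M n G X \<B> \<phi>"
    obtain m where m: "is_mean M n G m" "left_invariant M n G m"
      using mean by (auto simp: has_left_invariant_mean_def)
    obtain \<mu> where "space \<mu> = topspace X" "sets \<mu> = sigma_sets (topspace X) \<B>" "prob_space \<mu>"
      "\<And>g A. g \<in> carrier G \<Longrightarrow> A \<in> sets \<mu> \<Longrightarrow>
        emeasure \<mu> {x \<in> topspace X. \<phi> g x \<in> A} = emeasure \<mu> A"
      using invariant_measure_of_mean[OF m X] by blast
    then show "\<exists>\<mu>. space \<mu> = topspace X \<and> sets \<mu> = sigma_sets (topspace X) \<B> \<and> prob_space \<mu> \<and>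
        (\<forall>g\<in>carrier G. \<forall>A\<in>sets \<mu>.
          emeasure \<mu> {x \<in> topspace X. \<phi> g x \<in> A} = emeasure \<mu> A)"
      by (intro exI[of _ \<mu>]) simp
  qed
  show ?thesis
    by (intro conjI iffI impI)
      (erule fixed measure mean_of_fixed_point_property mean_of_invariant_measure_property)+
qed

end
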